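(* Let $G$ be a group acting by isometries on a $\delta$-hyperbolic geodesic metric space $\mathcal{H}$. Suppose that $g\in G$ satisfies the small cancellation property. Then any element $h\ne\mathrm{Id}$ in the normal subgroup $\langle\!\langle g\rangle\!\rangle\subset G$ satisfies the following alternative: either $h$ is a conjugate of $g$, or $h$ is a hyperbolic isometry with translation length $L(h)>L(g)$. In particular, if $n\ge 2$, the normal subgroup $\langle\!\langle g^n\rangle\!\rangle$ does not contain $g$.
   Context: For $f\in G$, $\langle\!\langle f\rangle\!\rangle$ denotes the normal subgroup of $G$ generated by $f$, i.e. the smallest normal subgroup of $G$ containing $f$. For a metric space $(\mathcal{H},\mathsf{d})$ the Gromov product is $(y|z)_x=\frac12(\mathsf{d}(y,x)+\mathsf{d}(z,x)-\mathsf{d}(y,z))$; $\mathcal{H}$ is $\delta$-hyperbolic if $(x|z)_w\ge\min\{(x|y)_w,(y|z)_w\}-\delta$ for all $x,y,z,w\in\mathcal{H}$. It is geodesic if any two points are joined by a geodesic segment. The space is not assumed locally compact and the action is not assumed proper. Here $\delta>0$ is fixed, and $\theta:=8\delta$. A geodesic line is (the image of) an isometric embedding of $\mathbf{R}$ in $\mathcal{H}$. The translation length of an isometry $f$ is $L(f)=\lim_{n\to\infty}\frac1n\mathsf{d}(x,f^n(x))$ (independent of $x$); $f$ is hyperbolic if its orbits are unbounded and $L(f)>0$. $\mathrm{Min}(f)=\{y\in\mathcal{H}:\mathsf{d}(y,f(y))=L(f)\}$. An invariant axis of $f$ is a geodesic line $\Gamma$ with $f(\Gamma)=\Gamma$.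 For $\alpha\geq 0$ and $A,A'\subset\mathcal{H}$, let $A\cap_\alpha A'=\{x\in\mathcal{H}:\mathsf{d}(x,A)\le\alpha\text{ and }\mathsf{d}(x,A')\le\alpha\}$. For $\varepsilon,B>0$, a subset $A$ is $(\varepsilon,B)$-rigid (with respect to $G$) if for every $f\in G$, $\mathrm{diam}(A\cap_\varepsilon f(A))\ge B$ implies $f(A)=A$; it is $\varepsilon$-rigid if it is $(\varepsilon,B)$-rigid for some $B>0$. An element $g\in G$ is tight if: it is hyperbolic and admits an invariant axis $\mathrm{Ax}(g)\subset\mathrm{Min}(g)$; the geodesic line $\mathrm{Ax}(g)$ is $2\theta$-rigid; and for all $f\in G$, if $f(\mathrm{Ax}(g))=\mathrm{Ax}(g)$ then $fgf^{-1}=g$ or $g^{-1}$. An element $g\in G$ satisfies the small cancellation property if it is tight, with an axis $\mathrm{Ax}(g)$ which is $(14\theta,B)$-rigid for some $B>0$ satisfying $\frac{L(g)}{20}\ge 60\,\theta+2B$.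
   Formalization: The first alternative reads "h is a conjugate of g or of g^{-1}" instead of "h is a conjugate of g"; as printed it fails for h = g^{-1}, e.g. for the integers acting on the real line by translations with g = 1, since L(g^{-1}) = L(g). *)

theory Defs
  imports "HOL-Analysis.Analysis" "HOL-Algebra.Group_Action"
begin

section \<open>Hyperbolic geodesic spaces\<close>

definition gromov_product :: "'h::metric_space \<Rightarrow> 'h \<Rightarrow> 'h \<Rightarrow> real" where
  "gromov_product x y z = (dist y x + dist z x - dist y z) / 2"

definition gromov_hyperbolic :: "real \<Rightarrow> 'h::metric_space set \<Rightarrow> bool" where
  "gromov_hyperbolic \<delta> X \<longleftrightarrow>
     (\<forall>x\<in>X. \<forall>y\<in>X. \<forall>z\<in>X. \<forall>w\<in>X.
        gromov_product w x z \<ge> min (gromov_product w x y) (gromov_product w y z) - \<delta>)"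

definition geodesic_space :: "'h::metric_space set \<Rightarrow> bool" where
  "geodesic_space X \<longleftrightarrow>
     (\<forall>x\<in>X. \<forall>y\<in>X. \<exists>c::real \<Rightarrow> 'h.
        c ` {0..dist x y} \<subseteq> X \<and> c 0 = x \<and> c (dist x y) = y \<and>
        (\<forall>s\<in>{0..dist x y}. \<forall>t\<in>{0..dist x y}. dist (c s) (c t) = \<bar>s - t\<bar>))"

definition geodesic_line :: "'h::metric_space set \<Rightarrow> bool" where
  "geodesic_line A \<longleftrightarrow>
     (\<exists>c::real \<Rightarrow> 'h. (\<forall>s t. dist (c s) (c t) = \<bar>s - t\<bar>) \<and> A = range c)"

section \<open>Isometries\<close>

definition is_isometry :: "('h::metric_space \<Rightarrow> 'h) \<Rightarrow> bool" where
  "is_isometry f \<longleftrightarrow> bij f \<and> (\<forall>x y. dist (f x) (f y) = dist x y)"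

text \<open>For an isometry the limit exists and does not depend on the base point
  (by subadditivity), so the description below is proper.\<close>

definition translation_length :: "('h::metric_space \<Rightarrow> 'h) \<Rightarrow> real" where
  "translation_length f =
     (THE l. \<forall>x. (\<lambda>n. dist x ((f ^^ n) x) / real n) \<longlonglongrightarrow> l)"

definition iterate_orbit :: "('h \<Rightarrow> 'h) \<Rightarrow> 'h \<Rightarrow> 'h set" where
  "iterate_orbit f x = range (\<lambda>n. (f ^^ n) x) \<union> range (\<lambda>n. (inv_into UNIV f ^^ n) x)"

definition hyperbolic_isometry :: "('h::metric_space \<Rightarrow> 'h) \<Rightarrow> bool" where
  "hyperbolic_isometry f \<longleftrightarrow>
     is_isometry f \<and> (\<forall>x. \<not> bounded (iterate_orbit f x)) \<and> translation_length f > 0"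

definition Min_set :: "('h::metric_space \<Rightarrow> 'h) \<Rightarrow> 'h set" where
  "Min_set f = {y. dist y (f y) = translation_length f}"

definition invariant_axis :: "('h::metric_space \<Rightarrow> 'h) \<Rightarrow> 'h set \<Rightarrow> bool" where
  "invariant_axis f A \<longleftrightarrow> geodesic_line A \<and> f ` A = A"

section \<open>Rigidity\<close>

text \<open>The diameter takes values in \<open>[0, \<infinity>]\<close>: the library's real-valued
  \<^const>\<open>diameter\<close> has no meaningful value on unbounded sets.\<close>

definition ediameter :: "'h::metric_space set \<Rightarrow> ennreal" where
  "ediameter S = (SUP x\<in>S. SUP y\<in>S. ennreal (dist x y))"

text \<open>Only used for nonempty sets; note that \<^const>\<open>infdist\<close> to the empty set is \<open>0\<close>.\<close>

definition thick_inter :: "real \<Rightarrow> 'h::metric_space set \<Rightarrow> 'h set \<Rightarrow> 'h set" where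
  "thick_inter \<alpha> A A' = {x. infdist x A \<le> \<alpha> \<and> infdist x A' \<le> \<alpha>}"

locale isometric_action = group_action G "UNIV :: 'h::metric_space set" \<phi>
  for G (structure) and \<phi> +
  assumes isometric: "g \<in> carrier G \<Longrightarrow> dist (\<phi> g x) (\<phi> g y) = dist x y"

definition rigid :: "('g, 'b) monoid_scheme \<Rightarrow> ('g \<Rightarrow> 'h::metric_space \<Rightarrow> 'h)
    \<Rightarrow> real \<Rightarrow> real \<Rightarrow> 'h set \<Rightarrow> bool" where
  "rigid G \<phi> \<epsilon> B A \<longleftrightarrow>
     (\<forall>f\<in>carrier G. ediameter (thick_inter \<epsilon> A (\<phi> f ` A)) \<ge> ennreal B \<longrightarrow> \<phi> f ` A = A)"

definition eps_rigid :: "('g, 'b) monoid_scheme \<Rightarrow> ('g \<Rightarrow> 'h::metric_space \<Rightarrow> 'h)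
    \<Rightarrow> real \<Rightarrow> 'h set \<Rightarrow> bool" where
  "eps_rigid G \<phi> \<epsilon> A \<longleftrightarrow> (\<exists>B>0. rigid G \<phi> \<epsilon> B A)"

section \<open>Tight elements and small cancellation\<close>

definition theta :: "real \<Rightarrow> real" where
  "theta \<delta> = 8 * \<delta>"

text \<open>\<open>A\<close> is the line \<open>Ax(g)\<close>. It is kept as an argument because the small cancellation
  property refers to the same line.\<close>

definition tight_with_axis :: "('g, 'b) monoid_scheme \<Rightarrow> ('g \<Rightarrow> 'h::metric_space \<Rightarrow> 'h)
    \<Rightarrow> real \<Rightarrow> 'g \<Rightarrow> 'h set \<Rightarrow> bool" where
  "tight_with_axis G \<phi> \<delta> g A \<longleftrightarrow>
     hyperbolic_isometry (\<phi> g) \<and>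
     invariant_axis (\<phi> g) A \<and> A \<subseteq> Min_set (\<phi> g) \<and>
     eps_rigid G \<phi> (2 * theta \<delta>) A \<and>
     (\<forall>f\<in>carrier G. \<phi> f ` A = A \<longrightarrow>
        f \<otimes>\<^bsub>G\<^esub> g \<otimes>\<^bsub>G\<^esub> inv\<^bsub>G\<^esub> f = g \<or> f \<otimes>\<^bsub>G\<^esub> g \<otimes>\<^bsub>G\<^esub> inv\<^bsub>G\<^esub> f = inv\<^bsub>G\<^esub> g)"

definition small_cancellation :: "('g, 'b) monoid_scheme \<Rightarrow> ('g \<Rightarrow> 'h::metric_space \<Rightarrow> 'h)
    \<Rightarrow> real \<Rightarrow> 'g \<Rightarrow> bool" where
  "small_cancellation G \<phi> \<delta> g \<longleftrightarrow>
     (\<exists>A. tight_with_axis G \<phi> \<delta> g A \<and>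
        (\<exists>B>0. rigid G \<phi> (14 * theta \<delta>) B A \<and>
           translation_length (\<phi> g) / 20 \<ge> 60 * theta \<delta> + 2 * B))"

section \<open>Normal closure and conjugacy\<close>

definition normal_closure :: "('g, 'b) monoid_scheme \<Rightarrow> 'g \<Rightarrow> 'g set" where
  "normal_closure G f = \<Inter>{N. N \<lhd> G \<and> f \<in> N}"

definition conjugate_in :: "('g, 'b) monoid_scheme \<Rightarrow> 'g \<Rightarrow> 'g \<Rightarrow> bool" where
  "conjugate_in G h g \<longleftrightarrow> (\<exists>f\<in>carrier G. h = f \<otimes>\<^bsub>G\<^esub> g \<otimes>\<^bsub>G\<^esub> inv\<^bsub>G\<^esub> f)"

end

theory Submission
  imports Defs "HOL-Algebra.Generated_Groups"
begin

text \<open>The translates of the axis A of g are lines on which conjugates of g act as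
  translations of length L. Rigidity makes the nearest-point projection of one such axis to
  another one much smaller than L, so the axes behave like the apices of a rotating family, with
  a translation of length L in place of a rotation by a large angle. The heart of the proof is
  an analogue of Greendlinger's lemma for small cancellation groups
  (\<open>normal_closure_moves_along_axis\<close>): for every point x and every nontrivial h in
  the normal closure of g there is an axis on which the projections of x and h x are almost L
  apart.

  This gives the alternative. If h has translation length at most L, the midpoint x of a
  geodesic from a point to its image satisfies \<open>dist x (h x) \<le> L + 6 \<delta>\<close>.
  Some axis uses up almost all of this distance, so x and h x are close to this axis, and one of
  the two conjugates of g and its inverse that translate along this axis brings x close to h x.
  The quotient of h by this conjugate moves x much less than L and is still in the normal
  closure, hence it is trivial. The statement on powers follows by applying the alternative to
  \<open>g [^] n\<close>, which has the same axis and translation length \<open>n * L\<close>.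

  For the analogue of Greendlinger's lemma, fix a base point and let \<open>N j\<close> be
  generated by the rotations about the axes at distance less than \<open>j * \<delta>\<close>
  from it. An element of \<open>N (j + 1)\<close> outside \<open>N j\<close> is an alternating
  product of elements of \<open>N j\<close> and rotations about new axes
  (\<open>chain_exists\<close>). If the orbit of the base point under \<open>N j\<close> has
  bounded projection to the new axes (\<open>narrow\<close>), each of these rotations makes
  progress by almost L, and the Behrstock inequality turns these local estimates into a global
  one (\<open>chain_left\<close>).

  It remains to prove that \<open>narrow\<close> passes from j to j + 1 with the same constant
  (\<open>narrow_Suc\<close>). The position of an avoided axis Y with respect to the rotations
  of a chain singles out one piece of the chain in level j, but comparing its ends with those of
  the whole chain costs an additive error. To keep these errors from accumulating, the induction
  does not replace the ends: it carries along two points far outside the piece and remembers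
  only that they project well to all axes of level j and to Y (\<open>anchored\<close>). That
  this is inherited by pieces rests on the fact that, seen from an axis of level j, an almost
  nearest point of a new axis is at most about half a turn away from the base point
  (\<open>avoided_axis_within_half_turn\<close>): otherwise a rotation in level j would bring
  the new axis closer.\<close>

section \<open>Nearest-point projections to geodesic lines\<close>

lemma four_point:
  fixes x y z w :: "'h::metric_space"
  assumes "gromov_hyperbolic \<delta> (UNIV :: 'h set)"
  shows "dist x z + dist y w \<le> max (dist x y + dist z w) (dist y z + dist x w) + 2 * \<delta>"
proof -
  have "gromov_product w x z \<ge> min (gromov_product w x y) (gromov_product w y z) - \<delta>"
    using assms by (auto simp: gromov_hyperbolic_def)
  then show ?thesis
    unfolding gromov_product_def by (simp add: min_def max_def field_simps split: if_splits)
qed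

text \<open>Nearest points need not be unique, so this is a choice. By
  \<open>dist_via_proj\<close> below, another choice would be at distance at most
  5\<delta>.\<close>

definition proj :: "'h::metric_space set \<Rightarrow> 'h \<Rightarrow> 'h" where
  "proj Y x = (SOME q. q \<in> Y \<and> (\<forall>y\<in>Y. dist x q \<le> dist x y))"

definition proj_dist :: "'h::metric_space set \<Rightarrow> 'h \<Rightarrow> 'h \<Rightarrow> real" where
  "proj_dist Y x z = dist (proj Y x) (proj Y z)"

lemma proj_dist_self [simp]: "proj_dist Y x x = 0"
  by (simp add: proj_dist_def)

lemma proj_dist_commute: "proj_dist Y x z = proj_dist Y z x"
  by (simp add: proj_dist_def dist_commute)

lemma proj_dist_triangle: "proj_dist Y x z \<le> proj_dist Y x u + proj_dist Y u z"
  by (simp add: proj_dist_def dist_triangle)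

lemma geodesic_lineE:
  assumes "geodesic_line Y"
  obtains c :: "real \<Rightarrow> 'h::metric_space"
    where "\<And>s t. dist (c s) (c t) = \<bar>s - t\<bar>" "Y = range c"
  using assms unfolding geodesic_line_def by blast

lemma geodesic_line_nearest_point:
  assumes "geodesic_line Y"
  shows "\<exists>q\<in>Y. \<forall>y\<in>Y. dist x q \<le> dist x y"
proof -
  obtain c where c: "\<And>s t. dist (c s) (c t) = \<bar>s - t\<bar>" "Y = range c"
    using assms by (rule geodesic_lineE) blast
  have cont: "continuous_on UNIV c"
    unfolding continuous_on_iff by (metis c(1) dist_real_def)
  let ?T = "{t. dist x (c t) \<le> dist x (c 0)}"
  have cont': "continuous_on UNIV (\<lambda>t. dist x (c t))"
    by (intro continuous_intros cont)
  have "closed ?T"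
    by (intro closed_Collect_le cont' continuous_intros)
  moreover have "bounded ?T"
  proof -
    have "\<bar>t\<bar> \<le> 2 * dist x (c 0)" if "t \<in> ?T" for t
      using that c(1)[of t 0] dist_triangle3[of "c t" "c 0" x] by (simp add: dist_commute)
    then show ?thesis unfolding bounded_iff by (metis real_norm_def)
  qed
  ultimately have "compact ?T" by (simp add: compact_eq_bounded_closed)
  moreover have "0 \<in> ?T" by simp
  ultimately obtain t where t: "t \<in> ?T" "\<forall>s\<in>?T. dist x (c t) \<le> dist x (c s)"
    using continuous_attains_inf[of ?T "\<lambda>t. dist x (c t)"] continuous_on_subset[OF cont']
    by blast
  then have "dist x (c t) \<le> dist x (c s)" for s
    by (cases "s \<in> ?T") auto
  then show ?thesis using c(2) by auto
qed

lemma
  assumes "geodesic_line Y"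
  shows proj_in: "proj Y x \<in> Y"
    and proj_nearest: "y \<in> Y \<Longrightarrow> dist x (proj Y x) \<le> dist x y"
proof -
  have "proj Y x \<in> Y \<and> (\<forall>y\<in>Y. dist x (proj Y x) \<le> dist x y)"
    unfolding proj_def by (rule someI_ex) (use geodesic_line_nearest_point[OF assms] in blast)
  then show "proj Y x \<in> Y" "y \<in> Y \<Longrightarrow> dist x (proj Y x) \<le> dist x y" by auto
qed

lemma infdist_eq_dist_proj:
  assumes "geodesic_line Y"
  shows "infdist x Y = dist x (proj Y x)"
proof (rule antisym)
  show "infdist x Y \<le> dist x (proj Y x)" by (simp add: infdist_le proj_in[OF assms])
  show "dist x (proj Y x) \<le> infdist x Y"
    using proj_in[OF assms, of x] proj_nearest[OF assms, of _ x]
    by (auto simp: infdist_def intro!: cINF_greatest)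
qed

lemma geodesic_line_point_between:
  assumes "geodesic_line Y" "p \<in> Y" "y \<in> Y" "0 \<le> r" "r \<le> dist p y"
  obtains m where "m \<in> Y" "dist p m = r" "dist m y = dist p y - r"
proof -
  obtain c where c: "\<And>s t. dist (c s) (c t) = \<bar>s - t\<bar>" "Y = range c"
    using assms(1) by (rule geodesic_lineE) blast
  obtain s t where st: "p = c s" "y = c t" using assms c(2) by auto
  define m where "m = c (if s \<le> t then s + r else s - r)"
  show ?thesis
    by (rule that[of m]) (use assms(4,5) in \<open>auto simp: m_def c st\<close>)
qed

text \<open>No point of Y is closer to x than the projection, so a geodesic from x to y cannot
  cut the corner there by more than a multiple of \<delta>.\<close>

lemma dist_via_proj:
  fixes x :: "'h::metric_space"
  assumes hyp: "gromov_hyperbolic \<delta> (UNIV :: 'h set)" and "\<delta> > 0"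
    and Y: "geodesic_line Y" "y \<in> Y"
  shows "dist x y \<ge> dist x (proj Y x) + dist (proj Y x) y - 5 * \<delta>"
proof (cases "dist (proj Y x) y \<le> 3 * \<delta>")
  case True
  then show ?thesis using proj_nearest[OF Y, of x] \<open>\<delta> > 0\<close> by linarith
next
  case False
  \<comment> \<open>for m at distance above 2\<delta> along Y, the four-point inequality can only hold through the
      term that contains dist x y\<close>
  obtain m where m: "m \<in> Y" "dist (proj Y x) m = 3 * \<delta>"
      "dist m y = dist (proj Y x) y - 3 * \<delta>"
    using geodesic_line_point_between[OF Y(1) proj_in[OF Y(1), of x] Y(2), of "3 * \<delta>"]
      False \<open>\<delta> > 0\<close> by auto
  have "dist x m \<ge> dist x (proj Y x)" by (rule proj_nearest[OF Y(1) m(1)])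
  with four_point[OF hyp, of x m "proj Y x" y] m \<open>\<delta> > 0\<close> show ?thesis
    by (auto simp: dist_commute max_def split: if_splits)
qed

text \<open>Of the two terms that can dominate in the four-point inequality for x, z and their
  projections, the sum of the distances of x and z to their own projections is too small once
  these projections are more than 6\<delta> apart.\<close>

lemma dist_via_two_projs:
  fixes x z :: "'h::metric_space"
  assumes hyp: "gromov_hyperbolic \<delta> (UNIV :: 'h set)" and "\<delta> > 0"
    and Y: "geodesic_line Y" and big: "proj_dist Y x z > 6 * \<delta>"
  shows "dist x z \<ge> infdist x Y + proj_dist Y x z + infdist z Y - 12 * \<delta>"
proof -
  note v = dist_via_proj[OF hyp \<open>\<delta> > 0\<close> Y proj_in[OF Y]]
  have "dist x (proj Y z) \<ge> infdist x Y + proj_dist Y x z - 5 * \<delta>"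
    using v[of x z] by (simp add: infdist_eq_dist_proj[OF Y] proj_dist_def)
  moreover have "dist z (proj Y x) \<ge> infdist z Y + proj_dist Y x z - 5 * \<delta>"
    using v[of z x] by (simp add: infdist_eq_dist_proj[OF Y] proj_dist_def dist_commute)
  ultimately show ?thesis
    using four_point[OF hyp, of x "proj Y z" z "proj Y x"] big
    by (auto simp: infdist_eq_dist_proj[OF Y] proj_dist_def dist_commute max_def split: if_splits)
qed

lemma proj_dist_le_of_dist_le:
  fixes x z :: "'h::metric_space"
  assumes hyp: "gromov_hyperbolic \<delta> (UNIV :: 'h set)" and "\<delta> > 0"
    and Y: "geodesic_line Y" and "dist x z \<le> infdist x Y + t" "t \<ge> 0"
  shows "proj_dist Y x z \<le> t + 12 * \<delta>"
proof (cases "proj_dist Y x z > 6 * \<delta>")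
  case True
  show ?thesis
    using dist_via_two_projs[OF hyp \<open>\<delta> > 0\<close> Y True] assms infdist_nonneg[of z Y] by linarith
next
  case False
  then show ?thesis using assms by linarith
qed

text \<open>The detour from z to z' through the two projections is nearly as short as a
  geodesic, so the point u of Z at the same distance from z as the projection of z is close to
  this projection.\<close>

lemma line_passes_near_proj:
  fixes z z' :: "'h::metric_space"
  assumes hyp: "gromov_hyperbolic \<delta> (UNIV :: 'h set)" and "\<delta> > 0"
    and Y: "geodesic_line Y" and Z: "geodesic_line Z" "z \<in> Z" "z' \<in> Z"
    and big: "proj_dist Y z z' > 12 * \<delta>"
  shows "infdist (proj Y z) Z \<le> 14 * \<delta>"
proof -
  let ?q = "proj Y z" and ?q' = "proj Y z'"
  have far: "dist z z' \<ge> dist z ?q + dist ?q ?q' + dist z' ?q' - 12 * \<delta>"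
    using dist_via_two_projs[OF hyp \<open>\<delta> > 0\<close> Y, of z z'] big \<open>\<delta> > 0\<close>
    by (simp add: infdist_eq_dist_proj[OF Y] proj_dist_def)
  have "dist z ?q \<le> dist z z'"
    using far big zero_le_dist[of z' ?q'] unfolding proj_dist_def by linarith
  then obtain u where u: "u \<in> Z" "dist z u = dist z ?q" "dist u z' = dist z z' - dist z ?q"
    using geodesic_line_point_between[OF Z, of "dist z ?q"] by auto
  have "dist ?q z' \<le> dist z z' - dist z ?q + 12 * \<delta>"
    using far dist_triangle[of ?q z' ?q'] by (simp add: dist_commute)
  then have "dist ?q u \<le> 14 * \<delta>"
    using four_point[OF hyp, of u ?q z z'] u \<open>\<delta> > 0\<close>
    by (auto simp: dist_commute max_def split: if_splits)
  then show ?thesis using infdist_le[OF u(1), of ?q] by linarith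
qed

text \<open>The Behrstock inequality. If both projection distances were large, geodesics from x
  to Z would pass along Y and geodesics from x to Y along Z, so each of the two lines would be
  farther from x than the other.\<close>

lemma behrstock:
  fixes x :: "'h::metric_space"
  assumes hyp: "gromov_hyperbolic \<delta> (UNIV :: 'h set)" and "\<delta> > 0"
    and Y: "geodesic_line Y" "y \<in> Y" and Z: "geodesic_line Z" "z \<in> Z"
    and smallY: "\<And>u v. u \<in> Z \<Longrightarrow> v \<in> Z \<Longrightarrow> proj_dist Y u v \<le> b"
    and smallZ: "\<And>u v. u \<in> Y \<Longrightarrow> v \<in> Y \<Longrightarrow> proj_dist Z u v \<le> b"
    and big: "proj_dist Y x z > b + 24 * \<delta>"
  shows "proj_dist Z x y \<le> b + 24 * \<delta>"
proof (rule ccontr)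
  assume "\<not> ?thesis"
  then have big': "proj_dist Z x y > b + 24 * \<delta>" by simp
  let ?q = "proj Y x" and ?r = "proj Z x"
  have q: "?q \<in> Y" and r: "?r \<in> Z" using proj_in Y Z by auto
  have 1: "proj_dist Y x ?r > 24 * \<delta>"
    using big smallY[OF r Z(2)] proj_dist_triangle[of Y x z ?r] by linarith
  have 2: "proj_dist Z x ?q > 24 * \<delta>"
    using big' smallZ[OF q Y(2)] proj_dist_triangle[of Z x y ?q] by linarith
  have "dist x ?r \<ge> dist x ?q + proj_dist Y x ?r - 12 * \<delta>"
    using dist_via_two_projs[OF hyp \<open>\<delta> > 0\<close> Y(1), of x ?r] 1 \<open>\<delta> > 0\<close> infdist_nonneg[of ?r Y]
    by (simp add: infdist_eq_dist_proj[OF Y(1), of x])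
  moreover have "dist x ?q \<ge> dist x ?r + proj_dist Z x ?q - 12 * \<delta>"
    using dist_via_two_projs[OF hyp \<open>\<delta> > 0\<close> Z(1), of x ?q] 2 \<open>\<delta> > 0\<close> infdist_nonneg[of ?q Z]
    by (simp add: infdist_eq_dist_proj[OF Z(1), of x])
  ultimately show False using 1 2 \<open>\<delta> > 0\<close> by linarith
qed

section \<open>Translation lengths\<close>

text \<open>Fekete's lemma: the limit is the infimum of the quotients, and dividing n by a
  number k that almost realises it gives the upper bound.\<close>

lemma subadditive_quotient_convergent:
  fixes a :: "nat \<Rightarrow> real"
  assumes sub: "\<And>m n. a (m + n) \<le> a m + a n" and nn: "\<And>n. a n \<ge> 0" and a0: "a 0 = 0"
  shows "\<exists>l. (\<lambda>n. a n / real n) \<longlonglongrightarrow> l"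
proof -
  let ?S = "(\<lambda>n. a n / real n) ` {1..}"
  define l where "l = Inf ?S"
  have bdd: "bdd_below ?S" by (rule bdd_belowI[of _ 0]) (use nn in auto)
  have lower: "l \<le> a n / real n" if "n \<ge> 1" for n
    unfolding l_def by (rule cInf_lower) (use that bdd in auto)
  have mult: "a (q * k) \<le> real q * a k" for q k
  proof (induction q)
    case (Suc q)
    then show ?case using sub[of k "q * k"] by (simp add: algebra_simps)
  qed (simp add: a0)
  have "(\<lambda>n. a n / real n) \<longlonglongrightarrow> l"
  proof (rule LIMSEQ_I)
    fix e :: real assume "e > 0"
    then have "\<exists>s\<in>?S. s < l + e / 2"
      using cInf_lessD[of ?S "l + e / 2"] by (auto simp: l_def)
    then obtain k where k: "k \<ge> 1" "a k / real k < l + e / 2" by auto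
    define M where "M = real k * a 1"
    obtain n0 :: nat where n0: "real n0 > 2 * M / e" using reals_Archimedean2 by blast
    show "\<exists>no. \<forall>n\<ge>no. norm (a n / real n - l) < e"
    proof (intro exI allI impI)
      fix n assume n: "n \<ge> max 1 n0"
      then have n1: "n \<ge> 1" "real n > 2 * M / e" using n0 by auto
      let ?q = "n div k" and ?r = "n mod k"
      have "a n \<le> a (?q * k) + a ?r" using sub[of "?q * k" ?r] by simp
      also have "a ?r \<le> real ?r * a 1" using mult[of ?r 1] by simp
      also have "\<dots> \<le> M" unfolding M_def
        by (rule mult_right_mono) (use k nn[of 1] in \<open>auto simp: less_imp_le\<close>)
      also have "a (?q * k) \<le> real ?q * a k" by (rule mult)
      also have "\<dots> \<le> real n / real k * a k"
        by (rule mult_right_mono[OF _ nn]) (rule of_nat_div_le_of_nat)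
      finally have "a n \<le> real n * (a k / real k) + M" by simp
      then have "a n / real n \<le> a k / real k + M / real n"
        using n1 by (simp add: field_simps)
      moreover have "M / real n < e / 2"
        using n1 \<open>e > 0\<close> by (simp add: field_simps)
      ultimately have "a n / real n < l + e" using k(2) by linarith
      then show "norm (a n / real n - l) < e"
        using lower[OF n1(1)] \<open>e > 0\<close> by simp
    qed
  qed
  then show ?thesis by blast
qed

lemma dist_funpow:
  fixes f :: "'h::metric_space \<Rightarrow> 'h"
  assumes "\<And>x y. dist (f x) (f y) = dist x y"
  shows "dist ((f ^^ n) x) ((f ^^ n) y) = dist x y"
  by (induction n) (auto simp: assms)

text \<open>Moving the base point changes the displacement of every iterate by at most a fixed
  amount, so it does not affect the limit.\<close>

lemma translation_limit_base_point:
  fixes f :: "'h::metric_space \<Rightarrow> 'h"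
  assumes iso: "\<And>x y. dist (f x) (f y) = dist x y"
    and lim: "(\<lambda>n. dist y ((f ^^ n) y) / real n) \<longlonglongrightarrow> l"
  shows "(\<lambda>n. dist x ((f ^^ n) x) / real n) \<longlonglongrightarrow> l"
proof -
  have "(\<lambda>n. dist x ((f ^^ n) x) / real n - dist y ((f ^^ n) y) / real n) \<longlonglongrightarrow> 0"
  proof (rule Lim_null_comparison)
    have "\<bar>dist x ((f ^^ n) x) - dist y ((f ^^ n) y)\<bar> \<le> 2 * dist x y" for n
      using dist_funpow[of f n x y, OF iso] dist_triangle[of x "(f ^^ n) x" y]
        dist_triangle[of y "(f ^^ n) x" "(f ^^ n) y"] dist_triangle[of y "(f ^^ n) y" x]
        dist_triangle[of x "(f ^^ n) y" "(f ^^ n) x"]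
      by (simp add: dist_commute)
    then show "\<forall>\<^sub>F n in sequentially. norm (dist x ((f ^^ n) x) / real n - dist y ((f ^^ n) y) / real n)
        \<le> 2 * dist x y / real n"
      by (intro always_eventually allI)
        (simp add: diff_divide_distrib[symmetric] divide_right_mono)
    show "(\<lambda>n. 2 * dist x y / real n) \<longlonglongrightarrow> 0"
      by (rule lim_const_over_n)
  qed
  from tendsto_add[OF this lim] show ?thesis by simp
qed

lemma translation_length_eqI:
  fixes f :: "'h::metric_space \<Rightarrow> 'h"
  assumes iso: "\<And>x y. dist (f x) (f y) = dist x y"
    and lim: "(\<lambda>n. dist y ((f ^^ n) y) / real n) \<longlonglongrightarrow> l"
  shows "translation_length f = l"
  unfolding translation_length_def
proof (rule the_equality)
  show "\<forall>x. (\<lambda>n. dist x ((f ^^ n) x) / real n) \<longlonglongrightarrow> l"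
    using translation_limit_base_point[OF iso lim] by blast
qed (use lim LIMSEQ_unique in blast)

lemma translation_length_tendsto:
  fixes f :: "'h::metric_space \<Rightarrow> 'h"
  assumes iso: "\<And>x y. dist (f x) (f y) = dist x y"
  shows "(\<lambda>n. dist x ((f ^^ n) x) / real n) \<longlonglongrightarrow> translation_length f"
proof -
  have "\<exists>l. (\<lambda>n. dist x ((f ^^ n) x) / real n) \<longlonglongrightarrow> l"
  proof (rule subadditive_quotient_convergent)
    fix m n
    show "dist x ((f ^^ (m + n)) x) \<le> dist x ((f ^^ m) x) + dist x ((f ^^ n) x)"
      using dist_triangle[of x "(f ^^ (m + n)) x" "(f ^^ m) x"]
        dist_funpow[of f m x "(f ^^ n) x", OF iso]
      by (simp add: funpow_add)
  qed auto
  then show ?thesis using translation_length_eqI[OF iso] by blast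
qed

lemma translation_length_ge:
  fixes f :: "'h::metric_space \<Rightarrow> 'h"
  assumes iso: "\<And>x y. dist (f x) (f y) = dist x y"
    and grow: "\<And>n. dist x ((f ^^ n) x) \<ge> real n * t"
  shows "translation_length f \<ge> t"
proof (rule LIMSEQ_le_const[OF translation_length_tendsto[OF iso, of x]])
  show "\<exists>N. \<forall>n\<ge>N. t \<le> dist x ((f ^^ n) x) / real n"
    using grow by (intro exI[of _ 1]) (simp add: field_simps)
qed

lemma hyperbolic_isometry_if_translation_length_pos:
  assumes "is_isometry f" "translation_length f > 0"
  shows "hyperbolic_isometry f"
  unfolding hyperbolic_isometry_def
proof (intro conjI allI notI)
  have iso: "\<And>x y. dist (f x) (f y) = dist x y" using assms by (simp add: is_isometry_def)
  fix x assume "bounded (iterate_orbit f x)"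
  then obtain b where b: "\<And>y. y \<in> iterate_orbit f x \<Longrightarrow> dist x y \<le> b"
    unfolding bounded_any_center[where a = x] by blast
  have "(f ^^ n) x \<in> iterate_orbit f x" for n by (simp add: iterate_orbit_def)
  then have b': "dist x ((f ^^ n) x) \<le> b" for n using b by blast
  have "(\<lambda>n. dist x ((f ^^ n) x) / real n) \<longlonglongrightarrow> 0"
    by (rule Lim_null_comparison[OF always_eventually lim_const_over_n[of b]])
      (use b' in \<open>auto simp: divide_right_mono\<close>)
  then have "translation_length f = 0" by (rule translation_length_eqI[OF iso])
  with assms show False by simp
qed (use assms in auto)

text \<open>If two steps of an isometry make more progress than one step by a margin above
  2\<delta>, the four-point condition propagates this margin to every further step.\<close>

lemma translation_length_ge_second_difference:
  fixes f :: "'h::metric_space \<Rightarrow> 'h"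
  assumes hyp: "gromov_hyperbolic \<delta> (UNIV :: 'h set)" and "\<delta> > 0"
    and iso: "\<And>x y. dist (f x) (f y) = dist x y"
  shows "translation_length f \<ge> dist x (f (f x)) - dist x (f x) - 2 * \<delta>"
proof -
  define t where "t = dist x (f (f x)) - dist x (f x) - 2 * \<delta>"
  have "translation_length f \<ge> t"
  proof (cases "t > 0")
    case False
    have "translation_length f \<ge> 0" by (rule translation_length_ge[OF iso, where x = x]) auto
    with False show ?thesis by simp
  next
    case True
    have step: "dist x ((f ^^ Suc n) x) \<ge> dist x ((f ^^ n) x) + t" for n
    proof (induction n)
      case 0
      show ?case using dist_triangle[of x "f (f x)" "f x"] \<open>\<delta> > 0\<close> by (simp add: t_def iso)
    next
      case (Suc n)
      have "dist ((f ^^ n) x) ((f ^^ Suc n) x) = dist x (f x)"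
        "dist ((f ^^ Suc n) x) ((f ^^ Suc (Suc n)) x) = dist x (f x)"
        "dist ((f ^^ n) x) ((f ^^ Suc (Suc n)) x) = dist x (f (f x))"
        using dist_funpow[OF iso, where n = n] by (simp_all add: funpow_swap1 iso)
      with four_point[OF hyp, of x "(f ^^ Suc n) x" "(f ^^ n) x" "(f ^^ Suc (Suc n)) x"] Suc True
      show ?case by (auto simp: t_def max_def dist_commute simp del: funpow.simps split: if_splits)
    qed
    have "dist x ((f ^^ n) x) \<ge> real n * t" for n
    proof (induction n)
      case (Suc n)
      then show ?case using step[of n] by (simp add: algebra_simps)
    qed simp
    then show ?thesis by (rule translation_length_ge[OF iso])
  qed
  then show ?thesis by (simp add: t_def)
qed

text \<open>The midpoint m of a geodesic from any point to its image works: the two ends of this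
  geodesic, which lead to the region of small displacement and back, do not contribute to the
  displacement of m.\<close>

lemma exists_almost_minimally_displaced_point:
  fixes f :: "'h::metric_space \<Rightarrow> 'h"
  assumes hyp: "gromov_hyperbolic \<delta> (UNIV :: 'h set)" and "\<delta> > 0"
    and geo: "geodesic_space (UNIV :: 'h set)"
    and iso: "\<And>x y. dist (f x) (f y) = dist x y"
  shows "\<exists>m. dist m (f m) \<le> translation_length f + 6 * \<delta>"
proof -
  fix x :: 'h
  define a where "a = dist x (f x)"
  define a2 where "a2 = dist x (f (f x))"
  obtain c :: "real \<Rightarrow> 'h" where c: "c 0 = x" "c a = f x"
      "\<And>s t. s \<in> {0..a} \<Longrightarrow> t \<in> {0..a} \<Longrightarrow> dist (c s) (c t) = \<bar>s - t\<bar>"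
    using geo unfolding geodesic_space_def a_def by (metis UNIV_I)
  define m where "m = c (a / 2)"
  have a0: "a \<ge> 0" by (simp add: a_def)
  have m: "dist x m = a / 2" "dist m (f x) = a / 2"
    using c(3)[of 0 "a / 2"] c(3)[of "a / 2" a] a0 by (simp_all add: c(1,2) m_def)
  then have fm: "dist (f x) (f m) = a / 2" "dist (f m) (f (f x)) = a / 2" by (simp_all add: iso)
  have ffx: "dist (f x) (f (f x)) = a" by (simp add: iso a_def)
  have "dist m (f (f x)) + a \<le> max (3 * a / 2) (a / 2 + a2) + 2 * \<delta>"
    using four_point[OF hyp, of m "f (f x)" x "f x"] m ffx
    by (auto simp: a_def[symmetric] a2_def[symmetric] dist_commute max_def split: if_splits)
  then have "dist m (f m) + a \<le> max a a2 + 4 * \<delta>"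
    using four_point[OF hyp, of m "f m" "f x" "f (f x)"] m fm ffx \<open>\<delta> > 0\<close>
    by (auto simp: dist_commute max_def split: if_splits)
  moreover have "translation_length f \<ge> 0"
    by (rule translation_length_ge[OF iso, where x = x]) auto
  moreover have "translation_length f \<ge> a2 - a - 2 * \<delta>"
    using translation_length_ge_second_difference[OF hyp \<open>\<delta> > 0\<close> iso, where x = x]
    by (simp add: a_def a2_def)
  ultimately have "dist m (f m) \<le> translation_length f + 6 * \<delta>"
    using \<open>\<delta> > 0\<close> by (auto simp: max_def split: if_splits)
  then show ?thesis by blast
qed

section \<open>The axes and their rotation groups\<close>

context group
begin

lemma inv_cancel_left [simp]:
  assumes "a \<in> carrier G" "b \<in> carrier G"
  shows "inv a \<otimes> (a \<otimes> b) = b" "a \<otimes> (inv a \<otimes> b) = b"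
  using assms by (simp_all add: m_assoc[symmetric])

lemma int_pow_conj:
  assumes [simp]: "h \<in> carrier G" "a \<in> carrier G"
  shows "(h \<otimes> a \<otimes> inv h) [^] (m::int) = h \<otimes> a [^] m \<otimes> inv h"
proof -
  have nat: "(h \<otimes> a \<otimes> inv h) [^] (n::nat) = h \<otimes> a [^] n \<otimes> inv h" for n
  proof (induction n)
    case (Suc n)
    then show ?case by (simp add: m_assoc)
  qed simp
  show ?thesis
  proof (cases m rule: int_cases2)
    case (nonneg n)
    then show ?thesis by (simp add: int_pow_int nat)
  next
    case (nonpos n)
    have "inv (h \<otimes> a [^] n \<otimes> inv h) = h \<otimes> inv (a [^] n) \<otimes> inv h"
      by (simp add: inv_mult_group m_assoc)
    then show ?thesis by (simp add: nonpos int_pow_neg_int nat)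
  qed
qed

end

context isometric_action
begin

sublocale group G
  using group_hom group_hom.axioms(1) by blast

lemma act_mult: "a \<in> carrier G \<Longrightarrow> b \<in> carrier G \<Longrightarrow> \<phi> (a \<otimes> b) x = \<phi> a (\<phi> b x)"
  by (simp add: composition_rule)

lemma act_one [simp]: "\<phi> \<one> x = x"
  by (simp add: id_eq_one[symmetric])

lemma act_inv [simp]:
  assumes "a \<in> carrier G"
  shows "\<phi> (inv a) (\<phi> a x) = x" "\<phi> a (\<phi> (inv a) x) = x"
  using assms by (simp_all add: act_mult[symmetric])

lemma act_image_mult:
  "a \<in> carrier G \<Longrightarrow> b \<in> carrier G \<Longrightarrow> \<phi> (a \<otimes> b) ` S = \<phi> a ` \<phi> b ` S"
  by (auto simp: act_mult image_iff)

lemma act_image_inv [simp]: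
  assumes "a \<in> carrier G"
  shows "\<phi> (inv a) ` \<phi> a ` S = S" "\<phi> a ` \<phi> (inv a) ` S = S"
  using assms by (simp_all add: act_image_mult[symmetric])

lemma act_is_isometry: "a \<in> carrier G \<Longrightarrow> is_isometry (\<phi> a)"
  using bij_prop0[of a] isometric by (auto simp: is_isometry_def Bij_def)

lemma act_pow: "a \<in> carrier G \<Longrightarrow> \<phi> (a [^] (n::nat)) x = (\<phi> a ^^ n) x"
proof (induction n arbitrary: x)
  case (Suc n)
  then show ?case by (simp add: act_mult funpow_swap1)
qed simp

lemma infdist_act:
  assumes "a \<in> carrier G"
  shows "infdist (\<phi> a x) (\<phi> a ` S) = infdist x S"
  using assms by (simp add: infdist_def image_image isometric)

lemma geodesic_line_act:
  assumes "a \<in> carrier G" "geodesic_line Y"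
  shows "geodesic_line (\<phi> a ` Y)"
proof -
  obtain c where c: "\<And>s t. dist (c s) (c t) = \<bar>s - t\<bar>" "Y = range c"
    using assms(2) by (rule geodesic_lineE) blast
  then show ?thesis
    unfolding geodesic_line_def
    by (intro exI[of _ "\<lambda>t. \<phi> a (c t)"]) (auto simp: isometric assms(1))
qed

end

text \<open>If one point moved forwards and another one backwards, these two points would be
  exchanged.\<close>

lemma constant_displacement_imp_translation:
  fixes \<sigma> :: "real \<Rightarrow> real"
  assumes iso: "\<And>s t. \<bar>\<sigma> s - \<sigma> t\<bar> = \<bar>s - t\<bar>" and disp: "\<And>t. \<bar>\<sigma> t - t\<bar> = l" and "l > 0"
  shows "(\<forall>t. \<sigma> t = t + l) \<or> (\<forall>t. \<sigma> t = t - l)"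
proof (rule ccontr)
  assume "\<not> ?thesis"
  then obtain s t where st: "\<sigma> s \<noteq> s - l" "\<sigma> t \<noteq> t + l" by auto
  then have s: "\<sigma> s = s + l" and t: "\<sigma> t = t - l"
    using disp[of s] disp[of t] by (auto simp: abs_if split: if_splits)
  then have "t = s + l" using iso[of s t] \<open>l > 0\<close> by (auto simp: abs_if split: if_splits)
  \<comment> \<open>s and t are exchanged, so their midpoint would be fixed\<close>
  with s t iso[of "s + l / 2" s] iso[of "s + l / 2" t] disp[of "s + l / 2"] \<open>l > 0\<close>
  show False by (auto simp: abs_if split: if_splits)
qed

text \<open>The part of the small cancellation property that the proof works with. It is
  isolated because it is inherited by the powers of g, with the same A and B and with L replaced
  by a multiple.\<close>

locale small_cancellation_axis = isometric_action G \<phi>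
  for G (structure) and \<phi> :: "'g \<Rightarrow> 'h::metric_space \<Rightarrow> 'h" +
  fixes \<delta> L B :: real and g :: 'g and A :: "'h set"
  assumes delta_pos: "\<delta> > 0"
    and hyp: "gromov_hyperbolic \<delta> (UNIV :: 'h set)"
    and g_closed [simp]: "g \<in> carrier G"
    and line_A: "geodesic_line A"
    and invariant_A: "\<phi> g ` A = A"
    and displacement_A: "y \<in> A \<Longrightarrow> dist y (\<phi> g y) = L"
    and stabilizer_A: "f \<in> carrier G \<Longrightarrow> \<phi> f ` A = A \<Longrightarrow>
        f \<otimes> g \<otimes> inv f = g \<or> f \<otimes> g \<otimes> inv f = inv g"
    and B_pos: "B > 0"
    and rigid_A: "rigid G \<phi> (14 * theta \<delta>) B A"
    and L_large: "L \<ge> 9600 * \<delta> + 40 * B"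
begin

lemma L_pos: "L > 0"
  using L_large delta_pos B_pos by linarith

definition axes :: "'h set set" where
  "axes = {\<phi> f ` A | f. f \<in> carrier G}"

text \<open>These elements translate along Y. They are called rotations because they play the
  role of the rotations about an apex in a rotating family.\<close>

definition rot :: "'h set \<Rightarrow> 'g set" where
  "rot Y = {f \<otimes> g [^] m \<otimes> inv f | f (m::int). f \<in> carrier G \<and> Y = \<phi> f ` A}"

lemma line_axes: "Y \<in> axes \<Longrightarrow> geodesic_line Y"
  using geodesic_line_act line_A by (auto simp: axes_def)

lemma act_axes:
  assumes "a \<in> carrier G" "Y \<in> axes"
  shows "\<phi> a ` Y \<in> axes"
proof -
  obtain f where f: "f \<in> carrier G" "Y = \<phi> f ` A" using assms(2) by (auto simp: axes_def)
  then have "\<phi> a ` Y = \<phi> (a \<otimes> f) ` A" using assms(1) by (simp add: act_image_mult)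
  then show ?thesis using assms(1) f(1) m_closed unfolding axes_def by blast
qed

lemma ediameter_ge: "x \<in> S \<Longrightarrow> y \<in> S \<Longrightarrow> ediameter S \<ge> ennreal (dist x y)"
  unfolding ediameter_def by (rule SUP_upper2, assumption, rule SUP_upper)

text \<open>If two points of Z had distant projections to Y, then Z would run along Y between
  these projections, at distance at most 14\<delta>. As this is less than
  \<open>14 * theta \<delta>\<close>, rigidity applies.\<close>

lemma axes_small_projection:
  assumes Y: "Y \<in> axes" and Z: "Z \<in> axes" and "Y \<noteq> Z" and z: "z \<in> Z" "z' \<in> Z"
  shows "proj_dist Y z z' \<le> B + 12 * \<delta>"
proof (rule ccontr)
  assume "\<not> ?thesis"
  then have big: "proj_dist Y z z' > B + 12 * \<delta>" by simp
  obtain f1 f2 where f: "f1 \<in> carrier G" "Y = \<phi> f1 ` A" "f2 \<in> carrier G" "Z = \<phi> f2 ` A"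
    using Y Z by (auto simp: axes_def)
  define h where "h = inv f1 \<otimes> f2"
  have h: "h \<in> carrier G" using f by (simp add: h_def)
  have Z_eq: "\<phi> f1 ` \<phi> h ` A = Z"
    using f by (simp add: h_def act_image_mult)
  let ?S = "thick_inter (14 * theta \<delta>) A (\<phi> h ` A)"
  have mem: "\<phi> (inv f1) (proj Y u) \<in> ?S" if "u \<in> {z, z'}" for u
  proof -
    have "infdist (proj Y u) Z \<le> 14 * \<delta>"
    proof -
      have "proj_dist Y z z' > 12 * \<delta>" "proj_dist Y z' z > 12 * \<delta>"
        using big B_pos by (simp_all add: proj_dist_commute[of Y z'])
      then show ?thesis
        using that line_passes_near_proj[OF hyp delta_pos line_axes[OF Y] line_axes[OF Z]] z
        by auto
    qed
    moreover have "infdist (\<phi> (inv f1) (proj Y u)) (\<phi> h ` A) = infdist (proj Y u) Z"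
      using infdist_act[of f1 "\<phi> (inv f1) (proj Y u)" "\<phi> h ` A"] f(1) by (simp add: Z_eq)
    moreover have "\<phi> (inv f1) (proj Y u) \<in> \<phi> (inv f1) ` Y"
      using proj_in[OF line_axes[OF Y]] by blast
    ultimately show ?thesis
      using f delta_pos by (simp add: thick_inter_def theta_def)
  qed
  have "ennreal B \<le> ennreal (proj_dist Y z z')"
    using big delta_pos by (intro ennreal_leI) simp
  also have "\<dots> \<le> ediameter ?S"
    using ediameter_ge[OF mem mem, of z z'] f by (simp add: proj_dist_def isometric)
  finally have "\<phi> h ` A = A" using rigid_A h by (simp add: rigid_def)
  then show False using Z_eq f \<open>Y \<noteq> Z\<close> by simp
qed

text \<open>The threshold of the Behrstock inequality for distinct axes, whose projections to
  each other have size at most \<open>B + 12 * \<delta>\<close>.\<close>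

definition P :: real where "P = B + 36 * \<delta>"

lemma axes_behrstock:
  assumes "Y \<in> axes" "Z \<in> axes" "Y \<noteq> Z" "y \<in> Y" "z \<in> Z" "proj_dist Y x z > P"
  shows "proj_dist Z x y \<le> P"
  using behrstock[OF hyp delta_pos line_axes[OF assms(1)] assms(4) line_axes[OF assms(2)] assms(5),
      of "B + 12 * \<delta>" x] axes_small_projection assms
  by (auto simp: P_def)

lemma axis_parametrization:
  obtains c :: "real \<Rightarrow> 'h" where "\<And>s t. dist (c s) (c t) = \<bar>s - t\<bar>" "A = range c"
    "\<And>(m::int) t. \<phi> (g [^] m) (c t) = c (t + of_int m * L)"
proof -
  obtain c0 :: "real \<Rightarrow> 'h" where c0: "\<And>s t. dist (c0 s) (c0 t) = \<bar>s - t\<bar>" "A = range c0"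
    using line_A by (rule geodesic_lineE) blast
  have "\<forall>t. \<exists>s. \<phi> g (c0 t) = c0 s" using invariant_A c0(2) by blast
  then obtain \<sigma> where \<sigma>: "\<And>t. \<phi> g (c0 t) = c0 (\<sigma> t)" by metis
  have "\<bar>\<sigma> s - \<sigma> t\<bar> = \<bar>s - t\<bar>" for s t
    using isometric[OF g_closed, of "c0 s" "c0 t"] by (simp add: \<sigma> c0(1))
  moreover have "\<bar>\<sigma> t - t\<bar> = L" for t
    using displacement_A[of "c0 t"] by (simp add: \<sigma> c0 abs_minus_commute)
  ultimately have "(\<forall>t. \<sigma> t = t + L) \<or> (\<forall>t. \<sigma> t = t - L)"
    using constant_displacement_imp_translation L_pos by blast
  then obtain c :: "real \<Rightarrow> 'h" where c: "\<And>s t. dist (c s) (c t) = \<bar>s - t\<bar>" "A = range c"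
    "\<And>t. \<phi> g (c t) = c (t + L)"
  proof
    assume "\<forall>t. \<sigma> t = t + L"
    then show ?thesis using that[of c0] c0 \<sigma> by simp
  next
    assume *: "\<forall>t. \<sigma> t = t - L"
    have "c0 t \<in> range (\<lambda>t. c0 (- t))" for t by (rule range_eqI[of _ _ "- t"]) simp
    then show ?thesis using that[of "\<lambda>t. c0 (- t)"] c0 \<sigma> * by (auto simp: abs_minus_commute)
  qed
  have nat: "\<phi> (g [^] n) (c t) = c (t + real n * L)" for n :: nat and t
    by (induction n arbitrary: t) (simp_all add: act_mult c(3) algebra_simps)
  have "\<phi> (g [^] m) (c t) = c (t + of_int m * L)" for m :: int and t
  proof (cases m rule: int_cases2)
    case (nonneg n)
    then show ?thesis using nat by (simp add: int_pow_int)
  next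
    case (nonpos n)
    have "\<phi> (inv (g [^] n)) (\<phi> (g [^] n) (c (t - real n * L))) = c (t - real n * L)"
      by (rule act_inv) simp
    then show ?thesis using nonpos by (simp add: nat int_pow_neg_int)
  qed
  with c show ?thesis using that by blast
qed

text \<open>Two elements that carry A to the same axis differ by an element stabilising A, and
  this conjugates g to itself or to its inverse. So the rotations about one axis are the powers
  of a single conjugate of g.\<close>

lemma rot_eq:
  assumes f: "f \<in> carrier G"
  shows "rot (\<phi> f ` A) = {f \<otimes> g [^] m \<otimes> inv f | m::int. True}"
proof (intro equalityI subsetI)
  fix b assume "b \<in> rot (\<phi> f ` A)"
  then obtain f' and m :: int
    where b: "f' \<in> carrier G" "\<phi> f ` A = \<phi> f' ` A" "b = f' \<otimes> g [^] m \<otimes> inv f'"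
    by (auto simp: rot_def)
  define h where "h = inv f \<otimes> f'"
  have h: "h \<in> carrier G" "f' = f \<otimes> h" using f b by (simp_all add: h_def)
  have "\<phi> h ` A = A"
    using f b(1) by (simp add: h_def act_image_mult flip: b(2))
  then have "h \<otimes> g \<otimes> inv h = g [^] (1::int) \<or> h \<otimes> g \<otimes> inv h = g [^] (-1::int)"
    using stabilizer_A[OF h(1)] by (simp add: int_pow_neg)
  then obtain e :: int where "h \<otimes> g \<otimes> inv h = g [^] e" by blast
  then have "h \<otimes> g [^] m \<otimes> inv h = g [^] (e * m)"
    using int_pow_conj[OF h(1) g_closed, of m] by (simp add: int_pow_pow)
  moreover have "b = f \<otimes> (h \<otimes> g [^] m \<otimes> inv h) \<otimes> inv f"
    using f h(1) by (simp add: b(3) h(2) inv_mult_group m_assoc)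
  ultimately show "b \<in> {f \<otimes> g [^] m \<otimes> inv f | m::int. True}" by auto
qed (use f in \<open>auto simp: rot_def\<close>)

lemma rot_closed: "b \<in> rot Y \<Longrightarrow> b \<in> carrier G"
  by (auto simp: rot_def)

lemma rot_subgroup:
  assumes "Y \<in> axes"
  shows "subgroup (rot Y) G"
proof -
  obtain f where f: "f \<in> carrier G" "Y = \<phi> f ` A" using assms by (auto simp: axes_def)
  show ?thesis
  proof (rule subgroupI)
    show "rot Y \<subseteq> carrier G" using rot_closed by blast
    show "rot Y \<noteq> {}" by (auto simp: f rot_eq)
  next
    fix a assume "a \<in> rot Y"
    then obtain m :: int where "a = f \<otimes> g [^] m \<otimes> inv f" using f by (auto simp: rot_eq)
    then have "inv a = f \<otimes> g [^] (- m) \<otimes> inv f"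
      using f by (simp add: inv_mult_group m_assoc int_pow_neg)
    then show "inv a \<in> rot Y" using f by (auto simp: rot_eq)
  next
    fix a b assume "a \<in> rot Y" "b \<in> rot Y"
    then obtain m n :: int
      where "a = f \<otimes> g [^] m \<otimes> inv f" "b = f \<otimes> g [^] n \<otimes> inv f"
      using f by (auto simp: rot_eq)
    then have "a \<otimes> b = f \<otimes> g [^] (m + n) \<otimes> inv f"
      using f by (simp add: m_assoc int_pow_mult)
    then show "a \<otimes> b \<in> rot Y" using f by (auto simp: rot_eq)
  qed
qed

lemma rot_conj:
  assumes "b \<in> rot Y" "h \<in> carrier G"
  shows "h \<otimes> b \<otimes> inv h \<in> rot (\<phi> h ` Y)"
proof -
  obtain f and m :: int where f: "f \<in> carrier G" "Y = \<phi> f ` A" "b = f \<otimes> g [^] m \<otimes> inv f"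
    using assms by (auto simp: rot_def)
  have "h \<otimes> b \<otimes> inv h = (h \<otimes> f) \<otimes> g [^] m \<otimes> inv (h \<otimes> f)"
    using f assms by (simp add: m_assoc inv_mult_group)
  moreover have "\<phi> h ` Y = \<phi> (h \<otimes> f) ` A" using f assms by (simp add: act_image_mult)
  ultimately show ?thesis using f(1) assms(2) rot_eq[of "h \<otimes> f"] by auto
qed

lemma rot_parametrization:
  assumes "f \<in> carrier G"
  obtains c :: "real \<Rightarrow> 'h" where "\<And>s t. dist (c s) (c t) = \<bar>s - t\<bar>" "\<phi> f ` A = range c"
    "\<And>(m::int) t. \<phi> (f \<otimes> g [^] m \<otimes> inv f) (c t) = c (t + of_int m * L)"
proof -
  obtain c :: "real \<Rightarrow> 'h" where c: "\<And>s t. dist (c s) (c t) = \<bar>s - t\<bar>" "A = range c"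
    "\<And>(m::int) t. \<phi> (g [^] m) (c t) = c (t + of_int m * L)"
    by (rule axis_parametrization) blast
  show ?thesis
  proof (rule that[of "\<lambda>t. \<phi> f (c t)"])
    show "\<phi> f ` A = range (\<lambda>t. \<phi> f (c t))" by (auto simp: c(2))
  qed (use assms c in \<open>simp_all add: isometric act_mult\<close>)
qed

lemma rot_fixes_axis:
  assumes "b \<in> rot Y"
  shows "\<phi> b ` Y = Y"
proof -
  obtain f and m :: int where f: "f \<in> carrier G" "Y = \<phi> f ` A" "b = f \<otimes> g [^] m \<otimes> inv f"
    using assms by (auto simp: rot_def)
  obtain c :: "real \<Rightarrow> 'h" where c: "\<And>s t. dist (c s) (c t) = \<bar>s - t\<bar>" "\<phi> f ` A = range c"
    "\<And>(m::int) t. \<phi> (f \<otimes> g [^] m \<otimes> inv f) (c t) = c (t + of_int m * L)"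
    using f(1) by (rule rot_parametrization) blast
  have "c ` range (\<lambda>t. of_int m * L + t) = range c"
    by (simp only: surj_plus)
  then have "range (\<lambda>t. c (t + of_int m * L)) = range c"
    by (simp only: image_image add.commute)
  then show ?thesis
    unfolding f(2,3) c(2) by (simp add: image_image c(3))
qed

lemma rot_displacement:
  assumes "b \<in> rot Y" "b \<noteq> \<one>" "y \<in> Y"
  shows "dist y (\<phi> b y) \<ge> L"
proof -
  obtain f and m :: int where f: "f \<in> carrier G" "Y = \<phi> f ` A" "b = f \<otimes> g [^] m \<otimes> inv f"
    using assms by (auto simp: rot_def)
  obtain c :: "real \<Rightarrow> 'h" where c: "\<And>s t. dist (c s) (c t) = \<bar>s - t\<bar>" "\<phi> f ` A = range c"
    "\<And>(m::int) t. \<phi> (f \<otimes> g [^] m \<otimes> inv f) (c t) = c (t + of_int m * L)"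
    using f(1) by (rule rot_parametrization) blast
  have "m \<noteq> 0" using assms(2) f by auto
  then have "1 * L \<le> \<bar>of_int m\<bar> * L" using L_pos by (intro mult_right_mono) auto
  then show ?thesis using assms(3) L_pos by (auto simp: f c abs_mult)
qed

lemma rot_towards:
  assumes "Y \<in> axes" "y \<in> Y" "z \<in> Y"
  obtains b where "b \<in> rot Y" "conjugate_in G b g \<or> conjugate_in G b (inv g)"
    "dist (\<phi> b y) z = \<bar>dist y z - L\<bar>"
proof -
  obtain f where f: "f \<in> carrier G" "Y = \<phi> f ` A" using assms by (auto simp: axes_def)
  obtain c :: "real \<Rightarrow> 'h" where c: "\<And>s t. dist (c s) (c t) = \<bar>s - t\<bar>" "\<phi> f ` A = range c"
    "\<And>(m::int) t. \<phi> (f \<otimes> g [^] m \<otimes> inv f) (c t) = c (t + of_int m * L)"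
    using f(1) by (rule rot_parametrization) blast
  obtain s t where st: "y = c s" "z = c t" using assms f c by auto
  define e :: int where "e = (if s \<le> t then 1 else -1)"
  show ?thesis
  proof (rule that[of "f \<otimes> g [^] e \<otimes> inv f"])
    show "f \<otimes> g [^] e \<otimes> inv f \<in> rot Y" using f by (auto simp: rot_def)
    have "g [^] e = g \<or> g [^] e = inv g" by (simp add: e_def int_pow_neg)
    then show "conjugate_in G (f \<otimes> g [^] e \<otimes> inv f) g \<or>
        conjugate_in G (f \<otimes> g [^] e \<otimes> inv f) (inv g)"
      using f(1) by (auto simp: conjugate_in_def)
    show "dist (\<phi> (f \<otimes> g [^] e \<otimes> inv f) y) z = \<bar>dist y z - L\<bar>"
      by (auto simp: st c e_def abs_if)
  qed
qed

text \<open>Projection commutes with an isometry preserving the line only up to 5\<delta>, the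
  bound for the distance between two nearest points.\<close>

lemma rot_proj_dist:
  assumes "Y \<in> axes" "b \<in> rot Y" "b \<noteq> \<one>"
  shows "proj_dist Y x (\<phi> b x) \<ge> L - 5 * \<delta>"
proof -
  note Y = line_axes[OF assms(1)]
  have b: "b \<in> carrier G" using assms(2) by (rule rot_closed)
  have 1: "\<phi> b (proj Y x) \<in> Y" using rot_fixes_axis[OF assms(2)] proj_in[OF Y] by blast
  have "dist (\<phi> b x) (\<phi> b (proj Y x)) = infdist (\<phi> b x) (\<phi> b ` Y)"
    using b by (simp add: isometric infdist_act infdist_eq_dist_proj[OF Y])
  then have "dist (\<phi> b x) (\<phi> b (proj Y x)) = dist (\<phi> b x) (proj Y (\<phi> b x))"
    by (simp add: rot_fixes_axis[OF assms(2)] infdist_eq_dist_proj[OF Y])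
  then have "dist (proj Y (\<phi> b x)) (\<phi> b (proj Y x)) \<le> 5 * \<delta>"
    using dist_via_proj[OF hyp delta_pos Y 1, of "\<phi> b x"] by simp
  moreover have "dist (proj Y x) (\<phi> b (proj Y x)) \<ge> L"
    by (rule rot_displacement[OF assms(2,3) proj_in[OF Y]])
  ultimately show ?thesis
    using dist_triangle[of "proj Y x" "\<phi> b (proj Y x)" "proj Y (\<phi> b x)"]
    unfolding proj_dist_def by linarith
qed

end

section \<open>The filtration of the normal closure by distance to the axes\<close>

locale based_small_cancellation_axis = small_cancellation_axis G \<phi> \<delta> L B g A
  for G (structure) and \<phi> :: "'g \<Rightarrow> 'h::metric_space \<Rightarrow> 'h"
    and \<delta> L B :: real and g :: 'g and A :: "'h set" +
  fixes x0 :: 'h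
begin

abbreviation pt :: "'g \<Rightarrow> 'h" where
  "pt p \<equiv> \<phi> p x0"

definition N :: "nat \<Rightarrow> 'g set" where
  "N j = generate G (\<Union>{rot Y | Y. Y \<in> axes \<and> infdist x0 Y < real j * \<delta>})"

text \<open>For an axis Y this says that \<open>\<phi> p\<close> does not carry to Y any axis in
  the \<open>N j\<close>-orbit of the axes at distance less than \<open>j * \<delta>\<close>
  from x0. Keeping p in the definition lets the arguments below work at any point of the orbit
  of x0 without translating back.\<close>

definition avoids :: "nat \<Rightarrow> 'g \<Rightarrow> 'h set \<Rightarrow> bool" where
  "avoids j p Y \<longleftrightarrow> (\<forall>m\<in>N j. infdist (pt (p \<otimes> m)) Y \<ge> real j * \<delta>)"

lemma N_subgroup: "subgroup (N j) G"
  unfolding N_def by (rule generate_is_subgroup) (use rot_closed in auto)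

lemma N_closed: "n \<in> N j \<Longrightarrow> n \<in> carrier G"
  using subgroup.mem_carrier[OF N_subgroup] .

lemma N_one [simp]: "\<one> \<in> N j"
  using subgroup.one_closed[OF N_subgroup] .

lemma N_mult: "m \<in> N j \<Longrightarrow> n \<in> N j \<Longrightarrow> m \<otimes> n \<in> N j"
  using subgroup.m_closed[OF N_subgroup] .

lemma N_inv: "n \<in> N j \<Longrightarrow> inv n \<in> N j"
  using subgroup.m_inv_closed[OF N_subgroup] .

lemma N_quotient_commute:
  assumes "p \<in> carrier G" "q \<in> carrier G" "inv p \<otimes> q \<in> N j"
  shows "inv q \<otimes> p \<in> N j"
  using N_inv[OF assms(3)] assms(1,2) by (simp add: inv_mult_group)

lemma N_quotient_trans:
  assumes "p \<in> carrier G" "q \<in> carrier G" "r \<in> carrier G" "inv p \<otimes> q \<in> N j" "inv q \<otimes> r \<in> N j"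
  shows "inv p \<otimes> r \<in> N j"
  using N_mult[OF assms(4,5)] assms(1-3) by (simp add: m_assoc)

lemma N_mono: "N j \<subseteq> N (Suc j)"
  unfolding N_def
proof (rule mono_generate, rule Union_mono, safe)
  fix Y assume "Y \<in> axes" "infdist x0 Y < real j * \<delta>"
  then show "\<exists>Y'. rot Y = rot Y' \<and> Y' \<in> axes \<and> infdist x0 Y' < real (Suc j) * \<delta>"
    using delta_pos by (intro exI[of _ Y]) (auto simp: algebra_simps)
qed

lemma N_0: "N 0 = {\<one>}"
proof -
  have "\<Union>{rot Y | Y. Y \<in> axes \<and> infdist x0 Y < real 0 * \<delta>} = {}"
    using infdist_nonneg[of x0] by (auto simp: not_less[symmetric])
  then show ?thesis unfolding N_def by (simp only: generate_empty)
qed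

lemma avoids_infdist:
  assumes "p \<in> carrier G" "avoids j p Y"
  shows "infdist (pt p) Y \<ge> real j * \<delta>"
proof -
  have "infdist (pt (p \<otimes> \<one>)) Y \<ge> real j * \<delta>"
    using assms(2) N_one unfolding avoids_def by blast
  then show ?thesis using assms(1) by simp
qed

lemma avoids_shift:
  assumes "p \<in> carrier G" "q \<in> carrier G" "inv p \<otimes> q \<in> N j" "avoids j p Y"
  shows "avoids j q Y"
  unfolding avoids_def
proof
  fix m assume m: "m \<in> N j"
  have "q \<otimes> m = p \<otimes> (inv p \<otimes> q \<otimes> m)"
    using assms N_closed[OF m] by (simp add: m_assoc)
  moreover have "inv p \<otimes> q \<otimes> m \<in> N j" using N_mult[OF assms(3) m] .
  ultimately show "infdist (pt (q \<otimes> m)) Y \<ge> real j * \<delta>"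
    using assms(4) by (simp add: avoids_def)
qed

lemma avoids_pred:
  assumes "avoids (Suc j) p Y"
  shows "avoids j p Y"
  unfolding avoids_def
proof
  fix m assume "m \<in> N j"
  then have "infdist (pt (p \<otimes> m)) Y \<ge> real (Suc j) * \<delta>"
    using assms N_mono unfolding avoids_def by blast
  then show "infdist (pt (p \<otimes> m)) Y \<ge> real j * \<delta>"
    using delta_pos by (simp add: algebra_simps)
qed

lemma infdist_pt_translate:
  assumes "a \<in> carrier G" "p \<in> carrier G"
  shows "infdist (pt (a \<otimes> p)) (\<phi> a ` Y) = infdist (pt p) Y"
  using assms by (simp add: act_mult infdist_act)

lemma avoids_translate:
  assumes "a \<in> carrier G" "p \<in> carrier G" "avoids j p Y"
  shows "avoids j (a \<otimes> p) (\<phi> a ` Y)"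
  unfolding avoids_def
proof
  fix m assume m: "m \<in> N j"
  then have "infdist (pt (a \<otimes> p \<otimes> m)) (\<phi> a ` Y) = infdist (pt (p \<otimes> m)) Y"
    using infdist_pt_translate[of a "p \<otimes> m" Y] assms N_closed[OF m] by (simp add: m_assoc)
  then show "infdist (pt (a \<otimes> p \<otimes> m)) (\<phi> a ` Y) \<ge> real j * \<delta>"
    using assms(3) m by (simp add: avoids_def)
qed

text \<open>An axis that is not avoided is carried back near x0 by the inverse of p m for some m
  in level j, and this conjugates b to one of the generators of level j.\<close>

lemma rot_in_N:
  assumes "Y \<in> axes" "p \<in> carrier G" "\<not> avoids j p Y" "b \<in> rot Y"
  shows "inv p \<otimes> b \<otimes> p \<in> N j"
proof -
  obtain m where m: "m \<in> N j" "infdist (pt (p \<otimes> m)) Y < real j * \<delta>"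
    using assms(3) by (auto simp: avoids_def not_le)
  note mG = N_closed[OF m(1)] and bG = rot_closed[OF assms(4)]
  define r where "r = p \<otimes> m"
  have rG: "r \<in> carrier G" using mG assms(2) by (simp add: r_def)
  have "infdist x0 (\<phi> (inv r) ` Y) = infdist (pt r) Y"
    using infdist_act[of "inv r" "pt r" Y] rG by simp
  then have "infdist x0 (\<phi> (inv r) ` Y) < real j * \<delta>" using m(2) by (simp add: r_def)
  moreover have "inv r \<otimes> b \<otimes> r \<in> rot (\<phi> (inv r) ` Y)"
    using rot_conj[OF assms(4), of "inv r"] rG by simp
  moreover have "\<phi> (inv r) ` Y \<in> axes" using act_axes assms(1) rG by simp
  ultimately have "inv r \<otimes> b \<otimes> r \<in> N j"
    unfolding N_def by (blast intro: generate.incl)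
  then have "m \<otimes> (inv r \<otimes> b \<otimes> r) \<otimes> inv m \<in> N j"
    by (rule N_mult[OF N_mult[OF m(1)] N_inv[OF m(1)]])
  moreover have "m \<otimes> (inv r \<otimes> b \<otimes> r) \<otimes> inv m = inv p \<otimes> b \<otimes> p"
    using assms(2) mG bG by (simp add: r_def m_assoc inv_mult_group)
  ultimately show ?thesis by simp
qed

text \<open>If s were farther away along W, then rotating about W by one turn would decrease the
  distance from the base point to s by more than \<delta>. But this rotation belongs to level j,
  and Z, being avoided, stays at distance at least \<open>j * \<delta>\<close> after it.\<close>

lemma avoided_axis_within_half_turn:
  assumes W: "W \<in> axes" "\<not> avoids j p W" and Z: "Z \<in> axes" "avoids j p Z"
    and p: "p \<in> carrier G" and s: "s \<in> Z" "dist (pt p) s < real (Suc j) * \<delta>"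
  shows "proj_dist W (pt p) s \<le> L / 2 + 7 * \<delta>"
proof (rule ccontr)
  assume "\<not> ?thesis"
  then have big: "proj_dist W (pt p) s > L / 2 + 7 * \<delta>" by simp
  note lW = line_axes[OF W(1)]
  let ?u = "proj W (pt p)" and ?w = "proj W s"
  obtain b where b: "b \<in> rot W" "dist (\<phi> b ?u) ?w = \<bar>dist ?u ?w - L\<bar>"
    using rot_towards[OF W(1) proj_in[OF lW] proj_in[OF lW]] by metis
  note bG = rot_closed[OF b(1)]
  have "inv p \<otimes> (b \<otimes> p) \<in> N j"
    using rot_in_N[OF W(1) p W(2) b(1)] p bG by (simp add: m_assoc)
  then have "avoids j (b \<otimes> p) Z" using avoids_shift[OF p _ _ Z(2)] p bG by simp
  then have "real j * \<delta> \<le> dist (pt (b \<otimes> p)) s"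
    using avoids_infdist[of "b \<otimes> p" j Z] infdist_le[OF s(1), of "pt (b \<otimes> p)"] p bG by simp
  also have "\<dots> \<le> dist (\<phi> b (pt p)) (\<phi> b ?u) + dist (\<phi> b ?u) ?w + dist ?w s"
    using dist_triangle[of "pt (b \<otimes> p)" s "\<phi> b ?u"] dist_triangle[of "\<phi> b ?u" s ?w] p bG
    by (simp add: act_mult)
  also have "\<dots> = infdist (pt p) W + \<bar>proj_dist W (pt p) s - L\<bar> + infdist s W"
    using b bG by (simp add: isometric infdist_eq_dist_proj[OF lW] proj_dist_def dist_commute)
  also have "\<dots> \<le> infdist (pt p) W + proj_dist W (pt p) s - 14 * \<delta> + infdist s W"
    using big delta_pos L_large B_pos by (simp add: abs_if)
  also have "\<dots> \<le> dist (pt p) s - 2 * \<delta>"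
    using dist_via_two_projs[OF hyp delta_pos lW, of "pt p" s] big delta_pos L_pos by simp
  finally show False using s(2) delta_pos by (simp add: algebra_simps)
qed

lemma proj_dist_avoided:
  assumes "Y \<in> axes" "p \<in> carrier G" "avoids j p Y" "dist (pt p) s < real (Suc j) * \<delta>"
  shows "proj_dist Y (pt p) s \<le> 13 * \<delta>"
  using proj_dist_le_of_dist_le[OF hyp delta_pos line_axes[OF assms(1)], of "pt p" s \<delta>]
    avoids_infdist[OF assms(2,3)] assms(4) delta_pos
  by (simp add: algebra_simps)

section \<open>Chains of rotations\<close>

text \<open>A chain describes an element of level j + 1 relative to F 0 by the path it traces in
  the orbit of x0: pieces in level j, from F i to E i, alternate with rotations from E i to F (i
  + 1) about axes that are new in level j + 1. It resembles a normal form in a free product,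
  with the path in place of the word. Indexing by k + 1 pieces and k rotations makes the
  definition symmetric under reversal.\<close>

definition chain :: "nat \<Rightarrow> nat \<Rightarrow> (nat \<Rightarrow> 'g) \<Rightarrow> (nat \<Rightarrow> 'g) \<Rightarrow> (nat \<Rightarrow> 'h set) \<Rightarrow> bool" where
  "chain j k E F Z \<longleftrightarrow>
     (\<forall>i\<le>k. E i \<in> carrier G \<and> F i \<in> carrier G \<and> inv (F i) \<otimes> E i \<in> N j) \<and>
     (\<forall>i<k. Z i \<in> axes \<and> F (Suc i) \<otimes> inv (E i) \<in> rot (Z i) \<and> F (Suc i) \<noteq> E i \<and>
        avoids j (E i) (Z i) \<and> infdist (pt (E i)) (Z i) < real (Suc j) * \<delta>) \<and>
     (\<forall>i. Suc i < k \<longrightarrow> Z i \<noteq> Z (Suc i))"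

lemma chainD:
  assumes "chain j k E F Z"
  shows "i \<le> k \<Longrightarrow> E i \<in> carrier G" "i \<le> k \<Longrightarrow> F i \<in> carrier G"
    "i \<le> k \<Longrightarrow> inv (F i) \<otimes> E i \<in> N j"
    "i < k \<Longrightarrow> Z i \<in> axes" "i < k \<Longrightarrow> F (Suc i) \<otimes> inv (E i) \<in> rot (Z i)"
    "i < k \<Longrightarrow> F (Suc i) \<noteq> E i" "i < k \<Longrightarrow> avoids j (E i) (Z i)"
    "i < k \<Longrightarrow> infdist (pt (E i)) (Z i) < real (Suc j) * \<delta>"
    "Suc i < k \<Longrightarrow> Z i \<noteq> Z (Suc i)"
  using assms by (auto simp: chain_def)

lemma chain_exit:
  assumes c: "chain j k E F Z" and i: "i < k"
  shows "avoids j (F (Suc i)) (Z i)" "infdist (pt (F (Suc i))) (Z i) < real (Suc j) * \<delta>"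
    "proj_dist (Z i) (pt (E i)) (pt (F (Suc i))) \<ge> L - 5 * \<delta>"
proof -
  define b where "b = F (Suc i) \<otimes> inv (E i)"
  have G: "E i \<in> carrier G" "F (Suc i) \<in> carrier G" using chainD(1,2)[OF c] i by auto
  have F: "F (Suc i) = b \<otimes> E i" using G by (simp add: b_def m_assoc)
  have b: "b \<in> rot (Z i)" using chainD(5)[OF c i] by (simp add: b_def)
  note bG = rot_closed[OF b]
  have "b \<noteq> \<one>" using chainD(6)[OF c i] F G by auto
  note bZ = rot_fixes_axis[OF b]
  show "avoids j (F (Suc i)) (Z i)"
    using avoids_translate[OF bG G(1) chainD(7)[OF c i]] by (simp add: F bZ)
  show "infdist (pt (F (Suc i))) (Z i) < real (Suc j) * \<delta>"
    using infdist_pt_translate[OF bG G(1), of "Z i"] chainD(8)[OF c i] by (simp add: F bZ)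
  show "proj_dist (Z i) (pt (E i)) (pt (F (Suc i))) \<ge> L - 5 * \<delta>"
    using rot_proj_dist[OF chainD(4)[OF c i] b \<open>b \<noteq> \<one>\<close>, of "pt (E i)"] bG G
    by (simp add: F act_mult)
qed

lemma chain_reverse:
  assumes c: "chain j k E F Z"
  shows "chain j k (\<lambda>i. F (k - i)) (\<lambda>i. E (k - i)) (\<lambda>i. Z (k - Suc i))"
  unfolding chain_def
proof (intro conjI allI impI)
  fix i assume "i \<le> k"
  then show "F (k - i) \<in> carrier G" "E (k - i) \<in> carrier G" using chainD(1,2)[OF c] by auto
  then show "inv (E (k - i)) \<otimes> F (k - i) \<in> N j"
    using chainD(3)[OF c, of "k - i"] by - (rule N_quotient_commute, auto)
next
  fix i assume i: "i < k"
  define i' where "i' = k - Suc i"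
  have i': "i' < k" "k - i = Suc i'" using i by (auto simp: i'_def)
  have G: "E i' \<in> carrier G" "F (Suc i') \<in> carrier G" using chainD(1,2)[OF c] i' by auto
  show "Z (k - Suc i) \<in> axes" using chainD(4)[OF c i'(1)] by (simp add: i'_def)
  have "inv (F (Suc i') \<otimes> inv (E i')) \<in> rot (Z i')"
    by (rule subgroup.m_inv_closed[OF rot_subgroup[OF chainD(4)[OF c i'(1)]] chainD(5)[OF c i'(1)]])
  then show "E (k - Suc i) \<otimes> inv (F (k - i)) \<in> rot (Z (k - Suc i))"
    using G by (simp add: i'(2) inv_mult_group flip: i'_def)
  show "E (k - Suc i) \<noteq> F (k - i)"
    using chainD(6)[OF c i'(1)] by (simp add: i'(2) flip: i'_def)
  show "avoids j (F (k - i)) (Z (k - Suc i))"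
    using chain_exit(1)[OF c i'(1)] by (simp add: i'(2) flip: i'_def)
  show "infdist (pt (F (k - i))) (Z (k - Suc i)) < real (Suc j) * \<delta>"
    using chain_exit(2)[OF c i'(1)] by (simp add: i'(2) flip: i'_def)
next
  fix i assume "Suc i < k"
  then show "Z (k - Suc i) \<noteq> Z (k - Suc (Suc i))"
    using chainD(9)[OF c, of "k - Suc (Suc i)"] by (simp add: Suc_diff_Suc)
qed

lemma chain_in_N:
  assumes c: "chain j k E F Z" and "i \<le> k"
  shows "inv (F 0) \<otimes> E i \<in> N (Suc j)"
  using \<open>i \<le> k\<close>
proof (induction i)
  case 0
  then show ?case using chainD(3)[OF c, of 0] N_mono by auto
next
  case (Suc i)
  then have i: "i < k" by simp
  have G: "F 0 \<in> carrier G" "E i \<in> carrier G" "F (Suc i) \<in> carrier G" "E (Suc i) \<in> carrier G"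
    using chainD(1,2)[OF c] Suc.prems by auto
  have "\<not> avoids (Suc j) (E i) (Z i)"
    using avoids_infdist[OF G(2), of "Suc j" "Z i"] chainD(8)[OF c i] by auto
  from rot_in_N[OF chainD(4)[OF c i] G(2) this chainD(5)[OF c i]]
  have "inv (E i) \<otimes> F (Suc i) \<in> N (Suc j)" using G by (simp add: m_assoc)
  then have "inv (F 0) \<otimes> F (Suc i) \<in> N (Suc j)"
    using Suc.IH i G by - (rule N_quotient_trans[of "F 0" "E i"], auto)
  moreover have "inv (F (Suc i)) \<otimes> E (Suc i) \<in> N (Suc j)"
    using chainD(3)[OF c Suc.prems] N_mono by auto
  ultimately show ?case
    using G by - (rule N_quotient_trans[of "F 0" "F (Suc i)"], auto)
qed

text \<open>A new rotation about the last axis of the chain has to be merged with the last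
  rotation, as consecutive axes must differ. The two may cancel, in which case the chain gets
  shorter.\<close>

lemma chain_extend:
  assumes c: "chain j k E F Z"
    and r: "r \<in> rot Y" and Y: "Y \<in> axes" "infdist x0 Y < real (Suc j) * \<delta>"
  shows "\<exists>k' E' F' Z'. chain j k' E' F' Z' \<and> F' 0 = F 0 \<and> E' k' = E k \<otimes> r"
proof (cases "r \<in> N j")
  case True
  have "chain j k (E(k := E k \<otimes> r)) F Z"
    using c N_closed[OF True] N_mult[OF chainD(3)[OF c order_refl] True]
    by (auto simp: chain_def m_assoc)
  then show ?thesis by (metis fun_upd_same)
next
  case False
  note D = chainD[OF c]
  define q where "q = E k"
  define V where "V = \<phi> q ` Y"
  define b where "b = q \<otimes> r \<otimes> inv q"
  have q: "q \<in> carrier G" using chainD(1)[OF c, of k] by (simp add: q_def)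
  have rG: "r \<in> carrier G" using rot_closed[OF r] .
  have bG: "b \<in> carrier G" using q rG by (simp add: b_def)
  have qr: "q \<otimes> r = b \<otimes> q" using q rG by (simp add: b_def m_assoc)
  have Er: "E k \<otimes> r = b \<otimes> q" using qr by (simp add: q_def)
  have V: "V \<in> axes" using act_axes q Y(1) by (simp add: V_def)
  have bV: "b \<in> rot V" using rot_conj[OF r q] by (simp add: b_def V_def)
  have "avoids j \<one> Y" using rot_in_N[OF Y(1) one_closed _ r] False rG by auto
  then have av: "avoids j q V" using avoids_translate[of q \<one> j Y] q by (simp add: V_def)
  have near: "infdist (pt q) V < real (Suc j) * \<delta>"
    using infdist_pt_translate[of q \<one> Y] q Y(2) by (simp add: V_def)
  have bq: "b \<otimes> q \<noteq> q"
  proof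
    assume "b \<otimes> q = q"
    then have "inv q \<otimes> (q \<otimes> r) = inv q \<otimes> q" by (simp add: qr)
    then have "r = \<one>" using q rG by simp
    then show False using False by simp
  qed
  show ?thesis
  proof (cases "k > 0 \<and> Z (k - 1) = V")
    case False
    let ?E = "E(Suc k := b \<otimes> q)" and ?F = "F(Suc k := b \<otimes> q)" and ?Z = "Z(k := V)"
    have "chain j (Suc k) ?E ?F ?Z"
      unfolding chain_def
    proof (intro conjI allI impI)
      fix i assume "i \<le> Suc k"
      then show "?E i \<in> carrier G" "?F i \<in> carrier G" "inv (?F i) \<otimes> ?E i \<in> N j"
        using D(1-3)[of i] bG q by (cases "i = Suc k"; simp)+
    next
      fix i assume "i < Suc k"
      then have "i = k \<or> i < k" by auto
      then show "?Z i \<in> axes" "?F (Suc i) \<otimes> inv (?E i) \<in> rot (?Z i)" "?F (Suc i) \<noteq> ?E i"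
        "avoids j (?E i) (?Z i)" "infdist (pt (?E i)) (?Z i) < real (Suc j) * \<delta>"
        using D(4-8)[of i] V bV bq av near bG q by (auto simp: m_assoc simp flip: q_def)
    next
      fix i assume "Suc i < Suc k"
      then show "?Z i \<noteq> ?Z (Suc i)" using D(9)[of i] False by (cases "Suc i = k") auto
    qed
    then show ?thesis
      by - (rule exI[of _ "Suc k"], rule exI[of _ ?E], rule exI[of _ ?F], rule exI[of _ ?Z], simp add: Er)
  next
    case True
    then obtain k0 where k0: "k = Suc k0" "Z k0 = V" by (cases k) auto
    have "k \<noteq> 0" using k0(1) by simp
    have G: "E k0 \<in> carrier G" "F k0 \<in> carrier G" "F k \<in> carrier G"
      using D(1,2) k0(1) by auto
    have last: "inv (b \<otimes> F k) \<otimes> (b \<otimes> q) \<in> N j"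
      using D(3)[of k] G bG q by (simp add: q_def inv_mult_group m_assoc)
    show ?thesis
    proof (cases "b \<otimes> F k = E k0")
      case True
      let ?E = "E(k0 := b \<otimes> q)"
      have step: "inv (F k0) \<otimes> (b \<otimes> q) \<in> N j"
        using D(3)[of k0] last k0(1) G bG q unfolding True
        by - (rule N_quotient_trans[of "F k0" "E k0"], auto)
      have "chain j k0 ?E F Z"
        unfolding chain_def
      proof (intro conjI allI impI)
        fix i assume "i \<le> k0"
        then show "?E i \<in> carrier G" "F i \<in> carrier G" "inv (F i) \<otimes> ?E i \<in> N j"
          using D(1-3)[of i] step bG q k0(1) by auto
      qed (use D(4-9) k0(1) in auto)
      then show ?thesis
        by - (rule exI[of _ k0], rule exI[of _ ?E], rule exI[of _ F], rule exI[of _ Z], simp add: Er)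
    next
      case False
      let ?E = "E(k := b \<otimes> q)" and ?F = "F(k := b \<otimes> F k)"
      have "b \<otimes> (F k \<otimes> inv (E k0)) \<in> rot V"
        using subgroup.m_closed[OF rot_subgroup[OF V] bV] D(5)[of k0] k0 by simp
      then have last': "b \<otimes> F k \<otimes> inv (E k0) \<in> rot V" using G bG by (simp add: m_assoc)
      have "chain j k ?E ?F Z"
        unfolding chain_def
      proof (intro conjI allI impI)
        fix i assume "i \<le> k"
        then show "?E i \<in> carrier G" "?F i \<in> carrier G" "inv (?F i) \<otimes> ?E i \<in> N j"
          using D(1-3)[of i] last bG q G by auto
      next
        fix i assume i: "i < k"
        then show "Z i \<in> axes" "avoids j (?E i) (Z i)"
          "infdist (pt (?E i)) (Z i) < real (Suc j) * \<delta>"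
          using D(4,7,8)[of i] by auto
        show "?F (Suc i) \<otimes> inv (?E i) \<in> rot (Z i)" "?F (Suc i) \<noteq> ?E i"
          using i D(5,6)[of i] last' False k0 by (cases "i = k0"; simp)+
      qed (use D(9) in auto)
      then show ?thesis
        using \<open>k \<noteq> 0\<close>
        by - (rule exI[of _ k], rule exI[of _ ?E], rule exI[of _ ?F], rule exI[of _ Z], simp add: Er)
    qed
  qed
qed

lemma chain_exists:
  assumes p: "p \<in> carrier G" and q: "q \<in> carrier G" and pq: "inv p \<otimes> q \<in> N (Suc j)"
  shows "\<exists>k E F Z. chain j k E F Z \<and> F 0 = p \<and> E k = q"
proof -
  let ?S = "\<Union>{rot Y | Y. Y \<in> axes \<and> infdist x0 Y < real (Suc j) * \<delta>}"
  have "\<exists>k' E' F' Z'. chain j k' E' F' Z' \<and> F' 0 = F 0 \<and> E' k' = E k \<otimes> n"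
    if "n \<in> generate G ?S" "chain j k E F Z" for n k E F Z
    using that
  proof (induction arbitrary: k E F Z rule: generate.induct)
    case one
    then show ?case using chainD(1)[OF one, of k] by auto
  next
    case (incl h)
    then show ?case using chain_extend by blast
  next
    case (inv h)
    then obtain Y where Y: "h \<in> rot Y" "Y \<in> axes" "infdist x0 Y < real (Suc j) * \<delta>" by blast
    then have "inv h \<in> rot Y" using subgroup.m_inv_closed[OF rot_subgroup] by blast
    then show ?case using chain_extend inv(2) Y by blast
  next
    case (eng h1 h2)
    obtain k1 E1 F1 Z1 where 1: "chain j k1 E1 F1 Z1" "F1 0 = F 0" "E1 k1 = E k \<otimes> h1"
      using eng.IH(1)[OF eng.prems] by blast
    obtain k2 E2 F2 Z2 where 2: "chain j k2 E2 F2 Z2" "F2 0 = F1 0" "E2 k2 = E1 k1 \<otimes> h2"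
      using eng.IH(2)[OF 1(1)] by blast
    have "h1 \<in> carrier G" "h2 \<in> carrier G"
      using eng.hyps N_closed unfolding N_def by blast+
    then show ?case using 1 2 chainD(1)[OF eng.prems order_refl] by (metis m_assoc)
  qed
  from this[OF pq[unfolded N_def], of 0 "\<lambda>_. p" "\<lambda>_. p" "\<lambda>_. {}"] p q
  show ?thesis by (auto simp: chain_def)
qed

end

section \<open>Chains make progress\<close>

context based_small_cancellation_axis
begin

text \<open>K bounds the projection of an orbit of level j to an axis that it avoids. It is
  twice the bound \<open>P + 13 * \<delta>\<close> for an anchored point, plus 2P for passing by
  a single rotation. M is half a turn, with the error 7\<delta> from
  \<open>avoided_axis_within_half_turn\<close> and one Behrstock error P.\<close>

definition K :: real where "K = 4 * P + 26 * \<delta>"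

definition M :: real where "M = L / 2 + P + 7 * \<delta>"

lemma constants: "0 < P" "L > M + 2 * K + 3 * P + 100 * \<delta>" "M > K + P + 100 * \<delta>"
  using L_large delta_pos B_pos by (simp_all add: K_def M_def P_def)

text \<open>An anchored point may stand in for pt p as the start of a path in level j that is
  observed from Y. On axes of level j it may be off by half a turn. This still leaves half of
  the progress made by the first rotation of a chain.\<close>

definition anchored :: "nat \<Rightarrow> 'h \<Rightarrow> 'g \<Rightarrow> 'h set \<Rightarrow> bool" where
  "anchored j v p Y \<longleftrightarrow>
     (\<forall>W\<in>axes. \<not> avoids j p W \<longrightarrow> proj_dist W v (pt p) \<le> M) \<and>
     proj_dist Y v (pt p) \<le> P + 13 * \<delta>"

text \<open>The case of interest is v = pt p and v' = pt q. Allowing all anchored points makes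
  the property inductive, because the same v and v' can be kept when a chain is cut down to one
  of its pieces.\<close>

definition narrow :: "nat \<Rightarrow> bool" where
  "narrow j \<longleftrightarrow> (\<forall>p\<in>carrier G. \<forall>q\<in>carrier G. \<forall>Y\<in>axes. \<forall>v v'.
     inv p \<otimes> q \<in> N j \<longrightarrow> avoids j p Y \<longrightarrow> anchored j v p Y \<longrightarrow> anchored j v' q Y \<longrightarrow>
     proj_dist Y v v' \<le> K)"

lemma narrowD:
  assumes "narrow j" "p \<in> carrier G" "q \<in> carrier G" "Y \<in> axes" "inv p \<otimes> q \<in> N j"
    "avoids j p Y" "anchored j v p Y" "anchored j v' q Y"
  shows "proj_dist Y v v' \<le> K"
  using assms unfolding narrow_def by blast

lemma anchored_pt: "anchored j (pt p) p Y"
  using constants delta_pos by (simp add: anchored_def K_def)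

lemma narrow_pt:
  assumes "narrow j" "p \<in> carrier G" "q \<in> carrier G" "Y \<in> axes" "inv p \<otimes> q \<in> N j" "avoids j p Y"
  shows "proj_dist Y (pt p) (pt q) \<le> K"
  using narrowD[OF assms anchored_pt anchored_pt] .

lemma anchored_pred:
  assumes "anchored (Suc j) v p Y"
  shows "anchored j v p Y"
  using assms avoids_pred unfolding anchored_def by blast

text \<open>As seen from the axis of a rotation, everything before this rotation projects near
  its starting point. For later axes the bound does not depend on M': the previous rotation has
  moved so far that the Behrstock inequality compares v with a point on the previous
  axis.\<close>

lemma chain_left:
  assumes n: "narrow j" and c: "chain j k E F Z"
    and v: "proj_dist (Z 0) v (pt (F 0)) \<le> M'" and "M' \<le> M" and i: "i < k"
  shows "proj_dist (Z i) v (pt (E i)) \<le> K + (if i = 0 then M' else P + 13 * \<delta>)"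
  using i
proof (induction i)
  case 0
  note D = chainD[OF c]
  have "avoids j (F 0) (Z 0)"
    using avoids_shift[of "E 0" "F 0" j "Z 0"] N_quotient_commute[OF _ _ D(3)] D(1,2,7) 0 by simp
  then have "proj_dist (Z 0) (pt (F 0)) (pt (E 0)) \<le> K"
    using narrow_pt[OF n] D(1,2,3,4) 0 by simp
  then show ?case using v proj_dist_triangle[of "Z 0" v "pt (E 0)" "pt (F 0)"] by simp
next
  case (Suc i)
  note D = chainD[OF c]
  have i: "i < k" "Suc i < k" "Suc i \<le> k" using Suc.prems by auto
  let ?Z = "Z i" and ?Z' = "Z (Suc i)" and ?f = "F (Suc i)" and ?e = "E (Suc i)"
  have G: "?f \<in> carrier G" "?e \<in> carrier G" using D(1,2) i by auto
  have fe: "inv ?f \<otimes> ?e \<in> N j" "inv ?e \<otimes> ?f \<in> N j"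
    using D(3)[of "Suc i"] N_quotient_commute[OF G] i by auto
  note Z = D(4)[OF i(1)] and Z' = D(4)[OF i(2)]
  note lZ = line_axes[OF Z] and lZ' = line_axes[OF Z']
  have av: "avoids j ?f ?Z" "avoids j ?e ?Z'" using chain_exit(1)[OF c i(1)] D(7)[OF i(2)] .
  have av': "avoids j ?e ?Z" "avoids j ?f ?Z'" using avoids_shift G fe av by blast+
  define s where "s = proj ?Z (pt ?f)"
  define s' where "s' = proj ?Z' (pt ?e)"
  have s: "s \<in> ?Z" "dist (pt ?f) s < real (Suc j) * \<delta>"
    using chain_exit(2)[OF c i(1)] by (simp_all add: s_def proj_in[OF lZ] infdist_eq_dist_proj[OF lZ])
  have s': "s' \<in> ?Z'" "dist (pt ?e) s' < real (Suc j) * \<delta>"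
    using D(8)[OF i(2)] by (simp_all add: s'_def proj_in[OF lZ'] infdist_eq_dist_proj[OF lZ'])
  have "proj_dist ?Z v (pt (E i)) \<le> K + M"
    using Suc.IH[OF i(1)] \<open>M' \<le> M\<close> constants delta_pos by (auto simp: K_def split: if_splits)
  moreover have "proj_dist ?Z (pt (E i)) (pt ?f) \<ge> L - 5 * \<delta>" by (rule chain_exit(3)[OF c i(1)])
  moreover have "proj_dist ?Z (pt ?f) (pt ?e) \<le> K"
    by (rule narrow_pt[OF n G Z fe(1) av(1)])
  moreover have "proj_dist ?Z (pt ?e) s' \<le> 13 * \<delta>"
    by (rule proj_dist_avoided[OF Z G(2) av'(1) s'(2)])
  ultimately have "proj_dist ?Z v s' > P"
    using proj_dist_triangle[of ?Z "pt (E i)" "pt ?f" v] proj_dist_triangle[of ?Z v "pt ?f" s']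
      proj_dist_triangle[of ?Z s' "pt ?f" "pt ?e"] proj_dist_commute[of ?Z] constants delta_pos
    by (smt (verit))
  then have "proj_dist ?Z' v s \<le> P"
    by (rule axes_behrstock[OF Z Z' D(9)[OF i(2)] s(1) s'(1)])
  moreover have "proj_dist ?Z' (pt ?f) s \<le> 13 * \<delta>"
    by (rule proj_dist_avoided[OF Z' G(1) av'(2) s(2)])
  moreover have "proj_dist ?Z' (pt ?f) (pt ?e) \<le> K"
    by (rule narrow_pt[OF n G Z' fe(1) av'(2)])
  ultimately show ?case
    using proj_dist_triangle[of ?Z' v "pt ?e" s] proj_dist_triangle[of ?Z' s "pt ?e" "pt ?f"]
      proj_dist_commute[of ?Z' s "pt ?f"] by simp
qed

text \<open>A point that is separated from Y by the axis Z i is anchored at the end of the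
  rotation about Z i, because Z i also separates it from all axes of level j at this end. To
  those axes and to Y, it projects near a point s of Z i, whose projections are controlled. No
  error is inherited from the anchoring of v at the start of the chain.\<close>

lemma chain_anchors_after:
  assumes n: "narrow j" and c: "chain j k E F Z"
    and v: "proj_dist (Z 0) v (pt (F 0)) \<le> M" and i: "i < k"
    and Y: "Y \<in> axes" "Y \<noteq> Z i" "y \<in> Y" "avoids j (F (Suc i)) Y"
    and far: "proj_dist (Z i) v y > P"
  shows "anchored j v (F (Suc i)) Y"
  unfolding anchored_def
proof (intro conjI ballI impI)
  note D = chainD[OF c]
  let ?Z = "Z i" and ?f = "F (Suc i)"
  have f: "?f \<in> carrier G" using D(2) i by simp
  note Z = D(4)[OF i]
  note lZ = line_axes[OF Z]
  have av: "avoids j ?f ?Z" by (rule chain_exit(1)[OF c i])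
  define s where "s = proj ?Z (pt ?f)"
  have s: "s \<in> ?Z" "dist (pt ?f) s < real (Suc j) * \<delta>"
    using chain_exit(2)[OF c i] by (simp_all add: s_def proj_in[OF lZ] infdist_eq_dist_proj[OF lZ])
  have "proj_dist Y v s \<le> P"
    using axes_behrstock[OF Z Y(1) _ s(1) Y(3) far] Y(2) by simp
  moreover have "proj_dist Y (pt ?f) s \<le> 13 * \<delta>"
    by (rule proj_dist_avoided[OF Y(1) f Y(4) s(2)])
  ultimately show "proj_dist Y v (pt ?f) \<le> P + 13 * \<delta>"
    using proj_dist_triangle[of Y v "pt ?f" s] proj_dist_commute[of Y s "pt ?f"] by simp
  fix W assume W: "W \<in> axes" "\<not> avoids j ?f W"
  note lW = line_axes[OF W(1)]
  obtain m where m: "m \<in> N j" "infdist (pt (?f \<otimes> m)) W < real j * \<delta>"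
    using W(2) by (auto simp: avoids_def not_le)
  have fm: "?f \<otimes> m \<in> carrier G" "inv ?f \<otimes> (?f \<otimes> m) \<in> N j"
    using f N_closed[OF m(1)] m(1) by simp_all
  define w where "w = proj W (pt (?f \<otimes> m))"
  have "dist (pt (?f \<otimes> m)) w < real j * \<delta>"
    using m(2) by (simp add: w_def infdist_eq_dist_proj[OF lW])
  then have w: "w \<in> W" "dist (pt (?f \<otimes> m)) w < real (Suc j) * \<delta>"
    using delta_pos by (simp_all add: w_def proj_in[OF lW] algebra_simps)
  have "proj_dist ?Z v (pt (E i)) \<le> K + M"
    using chain_left[OF n c v order_refl i] constants delta_pos by (auto simp: K_def split: if_splits)
  moreover have "proj_dist ?Z (pt (E i)) (pt ?f) \<ge> L - 5 * \<delta>" by (rule chain_exit(3)[OF c i])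
  moreover have "proj_dist ?Z (pt ?f) (pt (?f \<otimes> m)) \<le> K"
    by (rule narrow_pt[OF n f fm(1) Z fm(2) av])
  moreover have "proj_dist ?Z (pt (?f \<otimes> m)) w \<le> 13 * \<delta>"
    by (rule proj_dist_avoided[OF Z fm(1) avoids_shift[OF f fm av] w(2)])
  ultimately have "proj_dist ?Z v w > P"
    using proj_dist_triangle[of ?Z "pt (E i)" "pt ?f" v] proj_dist_triangle[of ?Z v "pt ?f" w]
      proj_dist_triangle[of ?Z w "pt ?f" "pt (?f \<otimes> m)"] proj_dist_commute[of ?Z] constants delta_pos
    by (smt (verit))
  moreover have "?Z \<noteq> W" using av W(2) by auto
  ultimately have "proj_dist W v s \<le> P"
    using axes_behrstock[OF Z W(1) _ s(1) w(1)] by blast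
  moreover have "proj_dist W (pt ?f) s \<le> L / 2 + 7 * \<delta>"
    by (rule avoided_axis_within_half_turn[OF W Z av f s])
  ultimately show "proj_dist W v (pt ?f) \<le> M"
    using proj_dist_triangle[of W v "pt ?f" s] proj_dist_commute[of W s "pt ?f"]
    by (simp add: M_def)
qed

lemma narrow_0: "narrow 0"
  unfolding narrow_def
proof (intro ballI allI impI)
  fix p q Y v v'
  assume pq: "p \<in> carrier G" "q \<in> carrier G" "inv p \<otimes> q \<in> N 0"
    and anch: "anchored 0 v p Y" "anchored 0 v' q Y"
  have "p \<otimes> (inv p \<otimes> q) = p \<otimes> \<one>" using pq(3) by (simp add: N_0)
  then have "q = p" using pq by simp
  then show "proj_dist Y v v' \<le> K"
    using anch proj_dist_triangle[of Y v v' "pt p"] proj_dist_commute[of Y v' "pt p"] constants(1)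
    by (simp add: anchored_def K_def)
qed

text \<open>Suppose that the axis of each rotation separates y from v or from v'. Take the piece
  of the chain just before the first axis that separates y from v', or the last piece if there
  is none. The axis before this piece, if any, separates y from v. So v and v' are anchored at
  the ends of this piece, and the assumption on level j applies. The only other possibility is a
  single rotation, because in a longer chain each rotation makes so much progress between v and
  v' that y cannot be close to both.\<close>

lemma narrow_Suc:
  assumes n: "narrow j"
  shows "narrow (Suc j)"
  unfolding narrow_def
proof (intro ballI allI impI)
  fix p q Y v v'
  assume p: "p \<in> carrier G" and q: "q \<in> carrier G" and Y: "Y \<in> axes" and pq: "inv p \<otimes> q \<in> N (Suc j)"
    and av: "avoids (Suc j) p Y"
    and anch: "anchored (Suc j) v p Y" "anchored (Suc j) v' q Y"
  obtain k E F Z where c: "chain j k E F Z" and ends: "F 0 = p" "E k = q"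
    using chain_exists[OF p q pq] by blast
  note D = chainD[OF c]
  obtain y where y: "y \<in> Y" using proj_in[OF line_axes[OF Y]] by blast
  have inN: "inv p \<otimes> E i \<in> N (Suc j)" if "i \<le> k" for i
    using chain_in_N[OF c that] by (simp add: ends)
  have avE: "avoids (Suc j) (E i) Y" if "i \<le> k" for i
    using avoids_shift[OF p D(1)[OF that] inN[OF that] av] .
  have avF: "avoids j (F i) Y" if "i \<le> k" for i
    using avoids_shift[OF D(1)[OF that] D(2)[OF that] N_quotient_commute[OF _ _ D(3)]]
      avoids_pred[OF avE[OF that]] D(1,2)[OF that] that by simp
  have not_av: "\<not> avoids (Suc j) (E i) (Z i)" if "i < k" for i
    using avoids_infdist[OF D(1), of i "Suc j" "Z i"] D(8)[OF that] that by auto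
  have YZ: "Y \<noteq> Z i" if "i < k" for i
    using not_av[OF that] avE[of i] that by auto
  have not_av_p: "\<not> avoids (Suc j) p (Z i)" "\<not> avoids (Suc j) q (Z i)" if "i < k" for i
  proof -
    show "\<not> avoids (Suc j) p (Z i)"
      using avoids_shift[OF p D(1) inN, of i "Z i"] not_av[OF that] that by auto
    then show "\<not> avoids (Suc j) q (Z i)"
      using avoids_shift[OF q p N_quotient_commute[OF p q pq]] by auto
  qed
  have cr: "chain j k (\<lambda>i. F (k - i)) (\<lambda>i. E (k - i)) (\<lambda>i. Z (k - Suc i))"
    by (rule chain_reverse[OF c])
  have left: "proj_dist (Z 0) v (pt (F 0)) \<le> M" if "k > 0"
    using anch(1) not_av_p(1)[OF that] D(4)[OF that] by (simp add: anchored_def ends)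
  have right: "proj_dist (Z (k - Suc 0)) v' (pt (E (k - 0))) \<le> M" if "k > 0"
    using anch(2) not_av_p(2)[of "k - Suc 0"] D(4)[of "k - Suc 0"] that
    by (simp add: anchored_def ends)
  show "proj_dist Y v v' \<le> K"
  proof (cases "\<exists>i<k. proj_dist (Z i) v y \<le> P \<and> proj_dist (Z i) v' y \<le> P")
    case True
    then obtain i where i: "i < k" "proj_dist (Z i) v y \<le> P" "proj_dist (Z i) v' y \<le> P" by blast
    let ?Z = "Z i"
    have k: "k > 0" using i by simp
    have ri: "k - Suc (k - Suc i) = i" "k - (k - Suc i) = Suc i" using i(1) by auto
    have l: "proj_dist ?Z v (pt (E i)) \<le> K + (if i = 0 then M else P + 13 * \<delta>)"
      by (rule chain_left[OF n c left[OF k] order_refl i(1)])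
    have r: "proj_dist ?Z v' (pt (F (Suc i))) \<le> K + (if k - Suc i = 0 then M else P + 13 * \<delta>)"
      using chain_left[OF n cr right[OF k] order_refl, of "k - Suc i"] i(1) by (simp add: ri)
    have mid: "proj_dist ?Z (pt (E i)) (pt (F (Suc i))) \<ge> L - 5 * \<delta>"
      by (rule chain_exit(3)[OF c i(1)])
    \<comment> \<open>half a turn can be lost only at the first and the last rotation\<close>
    have k1: "i = 0 \<and> k = Suc 0"
    proof (rule ccontr)
      assume *: "\<not> ?thesis"
      then have "i \<noteq> 0 \<or> k - Suc i \<noteq> 0" using i(1) by auto
      then have "proj_dist ?Z v (pt (E i)) + proj_dist ?Z v' (pt (F (Suc i))) \<le> 2 * K + M + P + 13 * \<delta>"
        using l r constants delta_pos by (auto simp: K_def split: if_splits)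
      then show False
        using mid i(2,3) proj_dist_triangle[of ?Z "pt (E i)" "pt (F (Suc i))" v]
          proj_dist_triangle[of ?Z v "pt (F (Suc i))" v'] proj_dist_triangle[of ?Z v v' y]
          proj_dist_commute[of ?Z] constants delta_pos
        by (smt (verit))
    qed
    then have i0: "i = 0" and k1: "k = Suc 0" by auto
    note Z = D(4)[OF i(1)]
    have Z0: "Z 0 \<in> axes" using Z i0 by simp
    obtain s where s: "s \<in> Z 0" using proj_in[OF line_axes[OF Z0]] by blast
    have G: "E 0 \<in> carrier G" "F 0 \<in> carrier G" "E (Suc 0) \<in> carrier G" "F (Suc 0) \<in> carrier G"
      using D(1,2) k1 by auto
    have av0: "avoids j (F 0) (Z 0)"
      using avoids_shift[OF G(1,2) N_quotient_commute[OF G(2,1) D(3)]] D(7) k1 by simp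
    have "proj_dist (Z 0) (pt (F 0)) (pt (E 0)) \<le> K"
      by (rule narrow_pt[OF n G(2,1) Z0 D(3) av0]) simp
    \<comment> \<open>now y is about half a turn away from both ends of the rotation, so Z 0 separates Y from
        p and from q\<close>
    then have "proj_dist (Z 0) (pt (F 0)) y > P"
      using l r mid i(2,3) k1 proj_dist_triangle[of "Z 0" "pt (E 0)" "pt (F (Suc 0))" v']
        proj_dist_triangle[of "Z 0" "pt (E 0)" v' y] proj_dist_triangle[of "Z 0" "pt (E 0)" y "pt (F 0)"]
        proj_dist_commute[of "Z 0"] constants delta_pos unfolding i0
      by (smt (verit) One_nat_def diff_self_eq_0)
    then have a: "proj_dist Y (pt p) s \<le> P"
      using axes_behrstock[OF Z0 Y _ s y] YZ[of 0] k1 by (simp add: ends)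
    have "proj_dist (Z 0) (pt (F (Suc 0))) (pt (E (Suc 0))) \<le> K"
      using narrow_pt[OF n G(4,3) Z0 D(3) chain_exit(1)[OF c, of 0]] k1 by simp
    then have "proj_dist (Z 0) (pt (E (Suc 0))) y > P"
      using l r mid i(2,3) k1 proj_dist_triangle[of "Z 0" "pt (E 0)" "pt (F (Suc 0))" v]
        proj_dist_triangle[of "Z 0" v "pt (F (Suc 0))" y] proj_dist_triangle[of "Z 0" y "pt (F (Suc 0))" "pt (E (Suc 0))"]
        proj_dist_commute[of "Z 0"] constants delta_pos unfolding i0
      by (smt (verit) One_nat_def diff_self_eq_0)
    then have b: "proj_dist Y (pt q) s \<le> P"
      using axes_behrstock[OF Z0 Y _ s y] YZ[of 0] k1 ends by simp
    show ?thesis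
      using a b anch proj_dist_triangle[of Y v v' "pt p"] proj_dist_triangle[of Y "pt p" v' s]
        proj_dist_triangle[of Y s v' "pt q"] proj_dist_commute[of Y s "pt q"] proj_dist_commute[of Y v' "pt q"]
      by (simp add: anchored_def K_def)
  next
    case False
    define i where "i = (LEAST i. i = k \<or> proj_dist (Z i) v' y > P)"
    have i: "i = k \<or> proj_dist (Z i) v' y > P"
      unfolding i_def by (rule LeastI[of _ k]) simp
    have ik: "i \<le> k" unfolding i_def by (rule Least_le) simp
    have "anchored j v (F i) Y"
    proof (cases i)
      case 0
      then show ?thesis using anchored_pred[OF anch(1)] by (simp add: ends)
    next
      case (Suc i')
      have i': "i' < k" using Suc ik by simp
      have "\<not> proj_dist (Z i') v' y > P"
        using not_less_Least[of i' "\<lambda>i. i = k \<or> proj_dist (Z i) v' y > P"] Suc i_def by auto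
      then have "proj_dist (Z i') v y > P" using False i' by (meson not_less)
      then show ?thesis
        using chain_anchors_after[OF n c left i' Y YZ[OF i'] y avF] Suc ik i' by auto
    qed
    moreover have "anchored j v' (E i) Y"
    proof (cases "i = k")
      case True
      then show ?thesis using anchored_pred[OF anch(2)] by (simp add: ends)
    next
      case neq: False
      then have lt: "i < k" using ik by simp
      have ri: "k - Suc (k - Suc i) = i" "k - Suc i < k" "k - Suc (k - Suc i) = i" using lt by auto
      have far: "proj_dist (Z i) v' y > P" using i neq by simp
      show ?thesis
        using chain_anchors_after[OF n cr right ri(2) Y, of y] YZ[OF lt] y far
          avoids_pred[OF avE[OF ik]] lt by (simp add: ri)
    qed
    ultimately show ?thesis
      using narrowD[OF n D(2)[OF ik] D(1)[OF ik] Y D(3)[OF ik] avF[OF ik]] by blast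
  qed
qed

lemma narrow_all: "narrow j"
  by (induction j) (simp_all add: narrow_0 narrow_Suc)

text \<open>In a chain for the first level that contains h, the first rotation already makes the
  required progress. No half turn is lost, because x0 and its image under h are the ends of the
  chain.\<close>

lemma nontrivial_moves_along_axis:
  assumes h: "h \<in> N j" "h \<noteq> \<one>"
  shows "\<exists>Y\<in>axes. proj_dist Y x0 (pt h) \<ge> L - 9 * B - 394 * \<delta>"
proof -
  define j' where "j' = (LEAST j. h \<in> N j)"
  have hj: "h \<in> N j'" unfolding j'_def by (rule LeastI[of "\<lambda>j. h \<in> N j", OF h(1)])
  have "j' \<noteq> 0" using hj h(2) N_0 by (cases "j' = 0") auto
  then obtain i where i: "j' = Suc i" by (cases j') auto
  have not: "h \<notin> N i" using not_less_Least[of i "\<lambda>j. h \<in> N j"] i j'_def by auto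
  have hG: "h \<in> carrier G" using N_closed[OF hj] .
  obtain k E F Z where c: "chain i k E F Z" and ends: "F 0 = \<one>" "E k = h"
    using chain_exists[OF one_closed hG, of i] hj hG i by auto
  have "k \<noteq> 0"
  proof
    assume "k = 0"
    then have "h \<in> N i" using chainD(3)[OF c, of 0] ends hG by simp
    then show False using not by simp
  qed
  then have k: "0 < k" by simp
  have M0: "0 \<le> M" using constants delta_pos by (simp add: K_def)
  have l: "proj_dist (Z 0) x0 (pt (E 0)) \<le> K"
    using chain_left[OF narrow_all c _ M0 k, of x0] by (simp add: ends)
  have "proj_dist (Z (k - Suc (k - Suc 0))) (pt h) (pt (F (k - (k - Suc 0)))) \<le>
      K + (if k - Suc 0 = 0 then 0 else P + 13 * \<delta>)"
    by (rule chain_left[OF narrow_all chain_reverse[OF c] _ M0]) (use k ends in auto)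
  then have r: "proj_dist (Z 0) (pt h) (pt (F (Suc 0))) \<le> K + P + 13 * \<delta>"
    using k constants(1) delta_pos by (auto split: if_splits)
  have "proj_dist (Z 0) x0 (pt h) \<ge> L - 9 * B - 394 * \<delta>"
    using l r chain_exit(3)[OF c k] proj_dist_triangle[of "Z 0" "pt (E 0)" "pt (F (Suc 0))" x0]
      proj_dist_triangle[of "Z 0" x0 "pt (F (Suc 0))" "pt h"] proj_dist_commute[of "Z 0"]
    by (simp add: K_def P_def)
  then show ?thesis using chainD(4)[OF c k] by blast
qed

end

section \<open>The normal closure\<close>

context small_cancellation_axis
begin

lemma translation_length_power:
  "translation_length (\<phi> (g [^] (n::nat))) = real n * L"
proof -
  obtain c :: "real \<Rightarrow> 'h" where c: "\<And>s t. dist (c s) (c t) = \<bar>s - t\<bar>" "A = range c"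
    "\<And>(m::int) t. \<phi> (g [^] m) (c t) = c (t + of_int m * L)"
    by (rule axis_parametrization) blast
  have "dist (c 0) ((\<phi> (g [^] n) ^^ k) (c 0)) = real k * (real n * L)" for k
  proof -
    have "(\<phi> (g [^] n) ^^ k) (c 0) = \<phi> (g [^] (n * k)) (c 0)"
      by (simp add: act_pow[symmetric] nat_pow_pow)
    also have "\<dots> = c (real (n * k) * L)"
      using c(3)[of "int (n * k)" 0] by (simp add: int_pow_int del: of_nat_mult)
    finally show ?thesis using L_pos by (simp add: c(1))
  qed
  then have "(\<lambda>k. dist (c 0) ((\<phi> (g [^] n) ^^ k) (c 0)) / real k) \<longlonglongrightarrow> real n * L"
    by (intro tendsto_eventually eventually_sequentiallyI[of 1]) simp
  then show ?thesis by (intro translation_length_eqI) (simp_all add: isometric)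
qed

lemma normal_closure_subset_generate:
  "normal_closure G g \<subseteq> generate G {f \<otimes> g \<otimes> inv f | f. f \<in> carrier G}"
proof -
  let ?S = "{f \<otimes> g \<otimes> inv f | f. f \<in> carrier G}"
  have "generate G ?S \<lhd> G"
  proof (rule normal_generateI)
    fix h a assume "h \<in> ?S" and a: "a \<in> carrier G"
    then obtain f where f: "f \<in> carrier G" "h = f \<otimes> g \<otimes> inv f" by blast
    then have "a \<otimes> h \<otimes> inv a = (a \<otimes> f) \<otimes> g \<otimes> inv (a \<otimes> f)"
      using a by (simp add: m_assoc inv_mult_group)
    then show "a \<otimes> h \<otimes> inv a \<in> ?S" using a f(1) m_closed by blast
  qed auto
  moreover have "g \<in> generate G ?S"
    by (rule generate.incl) (auto intro!: exI[of _ \<one>])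
  ultimately show ?thesis unfolding normal_closure_def by blast
qed

end

context based_small_cancellation_axis
begin

lemma N_mono_le: "i \<le> j \<Longrightarrow> N i \<subseteq> N j"
  by (rule lift_Suc_mono_le[of N]) (rule N_mono)

lemma normal_closure_in_N:
  assumes "h \<in> normal_closure G g"
  shows "\<exists>j. h \<in> N j"
proof -
  have conj: "\<exists>j. f \<otimes> g \<otimes> inv f \<in> N j" if f: "f \<in> carrier G" for f
  proof -
    obtain j :: nat where "real j > infdist x0 (\<phi> f ` A) / \<delta>" using reals_Archimedean2 by blast
    then have "infdist x0 (\<phi> f ` A) < real j * \<delta>" using delta_pos by (simp add: field_simps)
    moreover have "\<phi> f ` A \<in> axes" using f by (auto simp: axes_def)
    moreover have "f \<otimes> g [^] (1::int) \<otimes> inv f \<in> rot (\<phi> f ` A)"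
      using rot_eq[OF f] by blast
    ultimately have "f \<otimes> g [^] (1::int) \<otimes> inv f \<in> N j"
      unfolding N_def by (blast intro: generate.incl)
    then show ?thesis using int_pow_1[OF g_closed] by auto
  qed
  have "h \<in> generate G {f \<otimes> g \<otimes> inv f | f. f \<in> carrier G}"
    using assms normal_closure_subset_generate by blast
  then show ?thesis
  proof (induction rule: generate.induct)
    case one
    show ?case using N_one by blast
  next
    case (incl h)
    then show ?case using conj by auto
  next
    case (inv h)
    then show ?case using conj N_inv by blast
  next
    case (eng h1 h2)
    then obtain i j where ij: "h1 \<in> N i" "h2 \<in> N j" by blast
    have "h1 \<in> N (max i j)" "h2 \<in> N (max i j)"
      using ij N_mono_le[of i "max i j"] N_mono_le[of j "max i j"] by auto
    then show ?case using N_mult by blast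
  qed
qed

end

context small_cancellation_axis
begin

lemma normal_closure_moves_along_axis:
  assumes h: "h \<in> normal_closure G g" "h \<noteq> \<one>"
  shows "\<exists>Y\<in>axes. proj_dist Y x (\<phi> h x) \<ge> L - 9 * B - 394 * \<delta>"
proof -
  interpret based_small_cancellation_axis G \<phi> \<delta> L B g A x
    by unfold_locales
  show ?thesis using nontrivial_moves_along_axis normal_closure_in_N[OF h(1)] h(2) by blast
qed

lemma normal_closure_normal: "normal_closure G g \<lhd> G"
proof (rule normal_invI)
  have "carrier G \<in> {N. N \<lhd> G \<and> g \<in> N}" using normal_self by simp
  then show "subgroup (normal_closure G g) G"
    unfolding normal_closure_def
    by (intro subgroups_Inter) (auto intro: normal_imp_subgroup)
next
  fix x h assume x: "x \<in> carrier G" and h: "h \<in> normal_closure G g"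
  have "x \<otimes> h \<otimes> inv x \<in> N" if N: "N \<lhd> G" "g \<in> N" for N
    using normal.inv_op_closed2[OF N(1) x] h N by (simp add: normal_closure_def)
  then show "x \<otimes> h \<otimes> inv x \<in> normal_closure G g" by (simp add: normal_closure_def)
qed

lemma conjugate_in_normal_closure:
  assumes "conjugate_in G b g \<or> conjugate_in G b (inv g)"
  shows "b \<in> normal_closure G g"
proof -
  interpret N: normal "normal_closure G g" G by (rule normal_closure_normal)
  have "g \<in> normal_closure G g" by (auto simp: normal_closure_def)
  then show ?thesis
    using assms N.inv_op_closed2 N.m_inv_closed by (auto simp: conjugate_in_def)
qed

text \<open>Some point x is moved by h by at most \<open>L + 6 * \<delta>\<close>, and almost L
  of this happens along one axis. So x and h x are close to this axis, and the rotation by one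
  turn about it brings x near h x. The quotient of h by this rotation then moves x too little to
  be nontrivial.\<close>

lemma normal_closure_conjugate_if_small_translation_length:
  assumes geo: "geodesic_space (UNIV :: 'h set)"
    and h: "h \<in> normal_closure G g" "h \<noteq> \<one>" and small: "translation_length (\<phi> h) \<le> L"
  shows "conjugate_in G h g \<or> conjugate_in G h (inv g)"
proof -
  interpret N: normal "normal_closure G g" G by (rule normal_closure_normal)
  have hG: "h \<in> carrier G" using h(1) by (rule N.mem_carrier)
  obtain x where x: "dist x (\<phi> h x) \<le> L + 6 * \<delta>"
    using exists_almost_minimally_displaced_point[OF hyp delta_pos geo isometric[OF hG]] small
    by (meson add_mono order_refl order_trans)
  obtain Y where Y: "Y \<in> axes" "proj_dist Y x (\<phi> h x) \<ge> L - 9 * B - 394 * \<delta>"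
    using normal_closure_moves_along_axis[OF h] by blast
  note lY = line_axes[OF Y(1)]
  let ?u = "proj Y x" and ?w = "proj Y (\<phi> h x)"
  have far: "dist x (\<phi> h x) \<ge> infdist x Y + proj_dist Y x (\<phi> h x) + infdist (\<phi> h x) Y - 12 * \<delta>"
    by (rule dist_via_two_projs[OF hyp delta_pos lY]) (use Y(2) L_large delta_pos B_pos in linarith)
  obtain b where b: "b \<in> rot Y" "conjugate_in G b g \<or> conjugate_in G b (inv g)"
      "dist (\<phi> b ?u) ?w = \<bar>dist ?u ?w - L\<bar>"
    using rot_towards[OF Y(1) proj_in[OF lY] proj_in[OF lY]] by metis
  note bG = rot_closed[OF b(1)]
  have "inv b \<otimes> h = \<one>"
  proof (rule ccontr)
    assume neq: "inv b \<otimes> h \<noteq> \<one>"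
    have "inv b \<otimes> h \<in> normal_closure G g"
      using conjugate_in_normal_closure[OF b(2)] h(1) N.m_inv_closed N.m_closed by blast
    then obtain V where V: "V \<in> axes"
        "proj_dist V x (\<phi> (inv b \<otimes> h) x) \<ge> L - 9 * B - 394 * \<delta>"
      using normal_closure_moves_along_axis neq by blast
    have "dist x (\<phi> (inv b \<otimes> h) x) \<ge> proj_dist V x (\<phi> (inv b \<otimes> h) x) - 12 * \<delta>"
      using dist_via_two_projs[OF hyp delta_pos line_axes[OF V(1)], of x "\<phi> (inv b \<otimes> h) x"]
        V(2) L_large delta_pos B_pos infdist_nonneg[of x V] infdist_nonneg[of "\<phi> (inv b \<otimes> h) x" V]
      by linarith
    moreover have "dist x (\<phi> (inv b \<otimes> h) x) = dist (\<phi> b x) (\<phi> h x)"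
      using isometric[OF bG, of x "\<phi> (inv b \<otimes> h) x"] bG hG by (simp add: act_mult)
    moreover have "dist (\<phi> b x) (\<phi> h x) \<le> infdist x Y + \<bar>proj_dist Y x (\<phi> h x) - L\<bar> + infdist (\<phi> h x) Y"
      using dist_triangle[of "\<phi> b x" "\<phi> h x" "\<phi> b ?u"] dist_triangle[of "\<phi> b ?u" "\<phi> h x" ?w]
        b(3) isometric[OF bG, of x ?u]
      by (simp add: infdist_eq_dist_proj[OF lY] proj_dist_def dist_commute)
    ultimately show False
      using far x Y(2) V(2) L_large delta_pos B_pos infdist_nonneg[of x Y] infdist_nonneg[of "\<phi> h x" Y]
      by (simp add: abs_if split: if_splits)
  qed
  then have "b \<otimes> (inv b \<otimes> h) = b" using bG by simp
  then have "h = b" using bG hG by simp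
  then show ?thesis using b(2) by simp
qed

lemma normal_closure_alternative:
  assumes geo: "geodesic_space (UNIV :: 'h set)"
    and h: "h \<in> normal_closure G g" "h \<noteq> \<one>"
  shows "(conjugate_in G h g \<or> conjugate_in G h (inv g)) \<or>
    (hyperbolic_isometry (\<phi> h) \<and> translation_length (\<phi> h) > translation_length (\<phi> g))"
proof (cases "translation_length (\<phi> h) \<le> L")
  case True
  then show ?thesis using normal_closure_conjugate_if_small_translation_length[OF geo h] by blast
next
  case False
  interpret N: normal "normal_closure G g" G by (rule normal_closure_normal)
  have hG: "h \<in> carrier G" using h(1) by (rule N.mem_carrier)
  have "translation_length (\<phi> g) = L" using translation_length_power[of 1] by simp
  then show ?thesis
    using False L_pos hyperbolic_isometry_if_translation_length_pos[OF act_is_isometry[OF hG]] by simp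
qed

end

lemma (in isometric_action) translation_length_conjugate:
  assumes "conjugate_in G h k" "k \<in> carrier G"
  shows "translation_length (\<phi> h) = translation_length (\<phi> k)"
proof -
  obtain f where f: "f \<in> carrier G" "h = f \<otimes> k \<otimes> inv f"
    using assms(1) by (auto simp: conjugate_in_def)
  fix x
  have pow: "(\<phi> h ^^ n) (\<phi> f x) = \<phi> f ((\<phi> k ^^ n) x)" for n
    by (induction n) (use f assms(2) in \<open>simp_all add: act_mult\<close>)
  have "(\<lambda>n. dist (\<phi> f x) ((\<phi> h ^^ n) (\<phi> f x)) / real n) \<longlonglongrightarrow> translation_length (\<phi> k)"
    using translation_length_tendsto[OF isometric[OF assms(2)], of x] by (simp add: pow isometric f(1))
  then show ?thesis
    by (intro translation_length_eqI) (use f assms(2) in \<open>auto simp: isometric\<close>)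
qed

lemma (in isometric_action) translation_length_inv:
  assumes "k \<in> carrier G"
  shows "translation_length (\<phi> (inv k)) = translation_length (\<phi> k)"
proof -
  fix x
  have "dist x ((\<phi> (inv k) ^^ n) x) = dist x ((\<phi> k ^^ n) x)" for n
  proof -
    have "\<phi> (k [^] n) (\<phi> (inv k [^] n) x) = x"
      using assms by (simp add: nat_pow_inv)
    then have "dist x (\<phi> (inv k [^] n) x) = dist x (\<phi> (k [^] n) x)"
      using isometric[of "k [^] n" x "\<phi> (inv k [^] n) x"] assms by (simp add: dist_commute)
    then show ?thesis using assms by (simp add: act_pow)
  qed
  then have "(\<lambda>n. dist x ((\<phi> (inv k) ^^ n) x) / real n) \<longlonglongrightarrow> translation_length (\<phi> k)"
    using translation_length_tendsto[OF isometric[OF assms], of x] by simp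
  then show ?thesis
    by (intro translation_length_eqI) (use assms in \<open>auto simp: isometric\<close>)
qed

lemma (in small_cancellation_axis) small_cancellation_axis_power:
  assumes "n \<ge> 1"
  shows "small_cancellation_axis G \<phi> \<delta> (real n * L) B (g [^] (n::nat)) A"
proof
  obtain c :: "real \<Rightarrow> 'h" where c: "\<And>s t. dist (c s) (c t) = \<bar>s - t\<bar>" "A = range c"
    "\<And>(m::int) t. \<phi> (g [^] m) (c t) = c (t + of_int m * L)"
    by (rule axis_parametrization) blast
  have cn: "\<phi> (g [^] n) (c t) = c (t + real n * L)" for t
    using c(3)[of "int n" t] by (simp add: int_pow_int)
  have "g [^] n \<in> rot A" using rot_eq[OF one_closed] by (auto simp: int_pow_int[symmetric])
  then show "\<phi> (g [^] n) ` A = A" by (rule rot_fixes_axis)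
  show "dist y (\<phi> (g [^] n) y) = real n * L" if "y \<in> A" for y
    using that L_pos by (auto simp: c(1,2) cn)
  show "f \<otimes> g [^] n \<otimes> inv f = g [^] n \<or> f \<otimes> g [^] n \<otimes> inv f = inv (g [^] n)"
    if "f \<in> carrier G" "\<phi> f ` A = A" for f
    using stabilizer_A[OF that] int_pow_conj[OF that(1) g_closed, of "int n"]
    by (auto simp: int_pow_int nat_pow_inv)
  have "1 * L \<le> real n * L" using assms L_pos by (intro mult_right_mono) auto
  then show "real n * L \<ge> 9600 * \<delta> + 40 * B" using L_large by simp
qed (use delta_pos hyp line_A B_pos rigid_A in auto)

theorem theorem2p10:
  fixes G :: "('g, 'b) monoid_scheme" (structure)
    and \<phi> :: "'g \<Rightarrow> 'h::metric_space \<Rightarrow> 'h"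
    and \<delta> :: real and g :: 'g
  assumes "\<delta> > 0"
    and "geodesic_space (UNIV :: 'h set)"
    and "gromov_hyperbolic \<delta> (UNIV :: 'h set)"
    and "isometric_action G \<phi>"
    and "g \<in> carrier G"
    and "small_cancellation G \<phi> \<delta> g"
  shows "(\<forall>h\<in>normal_closure G g. h \<noteq> \<one> \<longrightarrow>
            (conjugate_in G h g \<or> conjugate_in G h (inv g)) \<or>
            (hyperbolic_isometry (\<phi> h) \<and>
             translation_length (\<phi> h) > translation_length (\<phi> g))) \<and>
         (\<forall>n::nat. n \<ge> 2 \<longrightarrow> g \<notin> normal_closure G (g [^] n))"
proof -
  interpret isometric_action G \<phi> by fact
  obtain A B where A: "tight_with_axis G \<phi> \<delta> g A" and B: "B > 0" "rigid G \<phi> (14 * theta \<delta>) B A"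
      "translation_length (\<phi> g) / 20 \<ge> 60 * theta \<delta> + 2 * B"
    using assms(6) unfolding small_cancellation_def by blast
  define L where "L = translation_length (\<phi> g)"
  interpret small_cancellation_axis G \<phi> \<delta> L B g A
  proof
    show "dist y (\<phi> g y) = L" if "y \<in> A" for y
      using A that by (auto simp: tight_with_axis_def Min_set_def L_def)
    show "L \<ge> 9600 * \<delta> + 40 * B" using B(3) by (simp add: L_def theta_def)
  qed (use assms A B in \<open>auto simp: tight_with_axis_def invariant_axis_def\<close>)
  have "g \<notin> normal_closure G (g [^] n)" if n: "n \<ge> 2" for n :: nat
  proof
    assume gn: "g \<in> normal_closure G (g [^] n)"
    interpret pow: small_cancellation_axis G \<phi> \<delta> "real n * L" B "g [^] n" A
      by (rule small_cancellation_axis_power) (use n in simp)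
    have Lg: "translation_length (\<phi> g) = L" "translation_length (\<phi> (g [^] n)) = real n * L"
      using translation_length_power[of 1] translation_length_power[of n] by simp_all
    have "1 * L < real n * L" using n L_pos by (intro mult_strict_right_mono) auto
    then have less: "L < real n * L" by simp
    have "g \<noteq> \<one>"
      using translation_length_power[of 0] Lg(1) L_pos by auto
    then have "conjugate_in G g (g [^] n) \<or> conjugate_in G g (inv (g [^] n)) \<or>
        translation_length (\<phi> g) > translation_length (\<phi> (g [^] n))"
      using pow.normal_closure_alternative[OF assms(2) gn] by blast
    then have "translation_length (\<phi> g) \<ge> translation_length (\<phi> (g [^] n))"
      using translation_length_conjugate[of g "g [^] n"] translation_length_conjugate[of g "inv (g [^] n)"]
        translation_length_inv[of "g [^] n"] by auto
    then show False using less Lg by simp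
  qed
  then show ?thesis using normal_closure_alternative[OF assms(2)] by blast
qed

end
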